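(* Let $\gamma$ be a planar extremal curve with non-constant curvature of the energy $\mathbf{\Theta}(\gamma)=\int_\gamma\kappa^{1/4}$, and let $S_\gamma$ denote the $\mathcal{I}$-invariant surface in $N^3(\rho)$ obtained by evolving $\gamma$ under the flow of the Killing field $\mathcal{I}$ which extends to $N^3(\rho)$ the vector field $\frac{1}{4\kappa^{3/4}}B$ along $\gamma$. Then $S_\gamma$ is a rotational linear Weingarten surface of $N^3(\rho)$ verifying $$3\kappa_1+\kappa_2=0$$ between its principal curvatures $\kappa_1,\kappa_2$, where $\kappa_1=-\kappa$ is minus the curvature of the profile curve; that is, $S_\gamma$ is a non-CMC biconservative surface.
   Context: $N^n(\rho)$ denotes the $n$-dimensional Riemannian space form of constant sectional curvature $\rho$. A planar curve of $N^3(\rho)$ is a curve with vanishing torsion; it can be assumed to lie in a totally geodesic surface $N^2(\rho)\subset N^3(\rho)$. For an arc-length parametrized non-geodesic curve $\gamma(s)$, $\{T,N,B\}$ is the Frenet frame, with binormal $B=T\times N$, and $\kappa\ge0$ is the curvature. An extremal (or critical) curve of $\mathbf{\Theta}(\gamma)=\int_\gamma\kappa^{1/4}\,ds$ is a curve satisfying the Euler--Lagrange equation $$\kappa^{3/4}\frac{d^2}{ds^2}\left(\frac{1}{\kappa^{3/4}}\right)-3\kappa^2+\rho=0 .$$ For such a curve $\mathcal{I}=\frac{1}{4\kappa^{3/4}}B$ is a Killing vector field along $\gamma$ (varying $\gamma$ in its direction preserves, infinitesimally, the speed and the curvature), and it extends to a Killing vector field on the whole $N^3(\rho)$, again denoted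 $\mathcal{I}$. With $\{\phi_t: t\in\mathbb{R}\}$ the one-parameter group of isometries determined by the flow of $\mathcal{I}$, $S_\gamma:=\{\phi_t(\gamma(s))\}$. Rotational surface: given a geodesic $\zeta$ of $N^3(\rho)$ (the axis), the group of all orientation-preserving isometries of $N^3(\rho)$ that are rotations with axis $\zeta$ is isomorphic to $SO(2)\simeq\mathbb{S}^1$ and fixes all the points of $\zeta$. A rotational surface is a surface of $N^3(\rho)$ invariant under such a group $SO(2)$; its profile curve is the curve everywhere orthogonal to the rotation which sweeps out the surface when rotated around $\zeta$. A linear Weingarten surface is here a surface whose principal curvatures satisfy $\kappa_1=a\kappa_2$ for some $a\in\mathbb{R}$. A surface isometrically immersed in $N^3(\rho)$, with unit normal vector field $\eta$, shape operator $S_\eta$ and mean curvature function $H=\frac12\operatorname{trace}S_\eta$, is biconservative if $2S_\eta(\operatorname{grad}H)+2H\operatorname{grad}H=0$; it is CMC if $H$ is constant, and non-CMC otherwise.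
   Formalization: For ρ<0 the claim that S_γ is rotational with profile curve γ is made only if the first integral (u')²+ρu²+9√κ, u=κ^(-3/4), is positive; otherwise the flow is by hyperbolic or parabolic isometries and the claim is false. All other conclusions hold without this condition. *)

theory Defs
  imports "HOL-Analysis.Analysis"
begin

section \<open>Smooth maps on open sets\<close>

primrec Ck_on :: "nat \<Rightarrow> 'a::euclidean_space set \<Rightarrow> ('a \<Rightarrow> 'b::euclidean_space) \<Rightarrow> bool" where
  "Ck_on 0 U f \<longleftrightarrow> continuous_on U f"
| "Ck_on (Suc k) U f \<longleftrightarrow>
     (\<exists>f'. (\<forall>p\<in>U. (f has_derivative f' p) (at p)) \<and> (\<forall>v. Ck_on k U (\<lambda>p. f' p v)))"

definition smooth_on :: "'a::euclidean_space set \<Rightarrow> ('a \<Rightarrow> 'b::euclidean_space) \<Rightarrow> bool" where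
  "smooth_on U f \<longleftrightarrow> (\<forall>k. Ck_on k U f)"

section \<open>The space forms of dimension three\<close>

text \<open>
  The complete, simply connected space of constant curvature \<open>\<rho>\<close> is represented by its standard
  model in four-dimensional space: the sphere of radius \<open>1 / sqrt \<rho>\<close> for \<open>\<rho> > 0\<close>, the affine
  hyperplane at height one (a copy of Euclidean three-space) for \<open>\<rho> = 0\<close>, and one sheet of the
  hyperboloid in Minkowski space for \<open>\<rho> < 0\<close>. The distinguished coordinate is the fourth one. In
  each case the Riemannian metric is the restriction of \<open>form \<rho>\<close> to the tangent spaces.
\<close>

definition form :: "real \<Rightarrow> real^4 \<Rightarrow> real^4 \<Rightarrow> real" where
  "form \<rho> x y = x$1 * y$1 + x$2 * y$2 + x$3 * y$3 + (if \<rho> < 0 then - 1 else 1) * (x$4 * y$4)"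

definition space_form :: "real \<Rightarrow> (real^4) set" where
  "space_form \<rho> =
     (if \<rho> = 0 then {p. p$4 = 1}
      else if \<rho> > 0 then {p. form \<rho> p p = 1 / \<rho>}
      else {p. form \<rho> p p = 1 / \<rho> \<and> p$4 > 0})"

definition tangent :: "real \<Rightarrow> real^4 \<Rightarrow> (real^4) set" where
  "tangent \<rho> p = (if \<rho> = 0 then {v. v$4 = 0} else {v. form \<rho> v p = 0})"

text \<open>
  The Levi-Civita derivative at \<open>p\<close>, in direction \<open>u\<close>, of a tangent field with value \<open>w\<close> at \<open>p\<close> and
  derivative \<open>w'\<close> (in the ambient vector space) in direction \<open>u\<close>. It is the tangential part of
  \<open>w'\<close>: for \<open>\<rho> \<noteq> 0\<close>, differentiating \<open>form \<rho> w p = 0\<close> gives \<open>form \<rho> w' p = - form \<rho> u w\<close>.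
\<close>

definition covariant :: "real \<Rightarrow> real^4 \<Rightarrow> real^4 \<Rightarrow> real^4 \<Rightarrow> real^4 \<Rightarrow> real^4" where
  "covariant \<rho> p u w w' = w' + (\<rho> * form \<rho> u w) *\<^sub>R p"

text \<open>
  A normal vector of the space form in the ambient space; together with the ambient determinant it
  fixes the orientation, for which the volume form is \<open>vol\<close>.
\<close>

definition conormal :: "real \<Rightarrow> real^4 \<Rightarrow> real^4" where
  "conormal \<rho> p = (if \<rho> = 0 then axis 4 1 else sqrt \<bar>\<rho>\<bar> *\<^sub>R p)"

definition vol :: "real \<Rightarrow> real^4 \<Rightarrow> real^4 \<Rightarrow> real^4 \<Rightarrow> real^4 \<Rightarrow> real" where
  "vol \<rho> p u v w = det (vector [u, v, w, conormal \<rho> p] :: real^4^4)"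

text \<open>
  The cross product of the tangent space at \<open>p\<close> is the vector with
  \<open>form \<rho> (cross \<rho> p u v) w = vol \<rho> p u v w\<close> for all \<open>w\<close>.
\<close>

definition cross :: "real \<Rightarrow> real^4 \<Rightarrow> real^4 \<Rightarrow> real^4 \<Rightarrow> real^4" where
  "cross \<rho> p u v = (\<chi> i. (if \<rho> < 0 \<and> i = 4 then - 1 else 1) * vol \<rho> p u v (axis i 1))"

text \<open>The Riemannian distance, in the closed form it takes in the models.\<close>

definition geo_dist :: "real \<Rightarrow> real^4 \<Rightarrow> real^4 \<Rightarrow> real" where
  "geo_dist \<rho> p q =
     (if \<rho> = 0 then dist p q
      else if \<rho> > 0 then arccos (\<rho> * form \<rho> p q) / sqrt \<rho>
      else arcosh (\<rho> * form \<rho> p q) / sqrt (- \<rho>))"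

section \<open>Curves\<close>

abbreviation velocity :: "(real \<Rightarrow> real^4) \<Rightarrow> real \<Rightarrow> real^4" where
  "velocity \<gamma> s \<equiv> vector_derivative \<gamma> (at s)"

definition covariant_along ::
    "real \<Rightarrow> (real \<Rightarrow> real^4) \<Rightarrow> (real \<Rightarrow> real^4) \<Rightarrow> real \<Rightarrow> real^4" where
  "covariant_along \<rho> \<gamma> V s =
     covariant \<rho> (\<gamma> s) (velocity \<gamma> s) (V s) (vector_derivative V (at s))"

definition arclength_curve :: "real \<Rightarrow> real set \<Rightarrow> (real \<Rightarrow> real^4) \<Rightarrow> bool" where
  "arclength_curve \<rho> J \<gamma> \<longleftrightarrow>
     open J \<and> is_interval J \<and> J \<noteq> {} \<and> smooth_on J \<gamma> \<and>
     (\<forall>s\<in>J. \<gamma> s \<in> space_form \<rho> \<and> form \<rho> (velocity \<gamma> s) (velocity \<gamma> s) = 1)"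

definition curvature :: "real \<Rightarrow> (real \<Rightarrow> real^4) \<Rightarrow> real \<Rightarrow> real" where
  "curvature \<rho> \<gamma> s =
     sqrt (form \<rho> (covariant_along \<rho> \<gamma> (velocity \<gamma>) s) (covariant_along \<rho> \<gamma> (velocity \<gamma>) s))"

definition frenet_normal :: "real \<Rightarrow> (real \<Rightarrow> real^4) \<Rightarrow> real \<Rightarrow> real^4" where
  "frenet_normal \<rho> \<gamma> s = (1 / curvature \<rho> \<gamma> s) *\<^sub>R covariant_along \<rho> \<gamma> (velocity \<gamma>) s"

definition binormal :: "real \<Rightarrow> (real \<Rightarrow> real^4) \<Rightarrow> real \<Rightarrow> real^4" where
  "binormal \<rho> \<gamma> s = cross \<rho> (\<gamma> s) (velocity \<gamma> s) (frenet_normal \<rho> \<gamma> s)"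

definition torsion :: "real \<Rightarrow> (real \<Rightarrow> real^4) \<Rightarrow> real \<Rightarrow> real" where
  "torsion \<rho> \<gamma> s = form \<rho> (covariant_along \<rho> \<gamma> (frenet_normal \<rho> \<gamma>) s) (binormal \<rho> \<gamma> s)"

definition planar :: "real \<Rightarrow> real set \<Rightarrow> (real \<Rightarrow> real^4) \<Rightarrow> bool" where
  "planar \<rho> J \<gamma> \<longleftrightarrow> (\<forall>s\<in>J. torsion \<rho> \<gamma> s = 0)"

text \<open>
  The Euler--Lagrange equation of the energy with density \<open>\<kappa> powr (1/4)\<close>. Positivity of the
  curvature is what makes the Frenet frame and the negative powers of \<open>\<kappa>\<close> meaningful.
\<close>

definition extremal :: "real \<Rightarrow> real set \<Rightarrow> (real \<Rightarrow> real^4) \<Rightarrow> bool" where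
  "extremal \<rho> J \<gamma> \<longleftrightarrow>
     (\<forall>s\<in>J. curvature \<rho> \<gamma> s > 0 \<and>
        curvature \<rho> \<gamma> s powr (3/4) * deriv (deriv (\<lambda>r. 1 / curvature \<rho> \<gamma> r powr (3/4))) s
          - 3 * (curvature \<rho> \<gamma> s)\<^sup>2 + \<rho> = 0)"

text \<open>
  With \<open>u = 1 / \<kappa> powr (3/4)\<close> the Euler--Lagrange equation reads \<open>u'' = 3 * \<kappa>\<^sup>2 * u - \<rho> * u\<close>, so that
  \<open>u'\<^sup>2 + \<rho> * u\<^sup>2 + 9 * sqrt \<kappa>\<close> is constant along an extremal curve. For \<open>\<rho> \<ge> 0\<close> it is positive;
  for \<open>\<rho> < 0\<close> its sign tells whether the isometries generated by the Killing field of the curve are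
  rotations about a geodesic (positive), parabolic (zero) or translations along one (negative).
\<close>

definition first_integral :: "real \<Rightarrow> (real \<Rightarrow> real^4) \<Rightarrow> real \<Rightarrow> real" where
  "first_integral \<rho> \<gamma> s =
     (deriv (\<lambda>r. 1 / curvature \<rho> \<gamma> r powr (3/4)) s)\<^sup>2
       + \<rho> * (1 / curvature \<rho> \<gamma> s powr (3/4))\<^sup>2 + 9 * sqrt (curvature \<rho> \<gamma> s)"

section \<open>Killing fields, isometries and rotations\<close>

text \<open>A field is smooth on the space form if it extends smoothly to an open neighbourhood of it.\<close>

definition killing_field :: "real \<Rightarrow> (real^4 \<Rightarrow> real^4) \<Rightarrow> bool" where
  "killing_field \<rho> X \<longleftrightarrow>
     (\<forall>p\<in>space_form \<rho>. X p \<in> tangent \<rho> p) \<and>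
     (\<exists>U Y. open U \<and> space_form \<rho> \<subseteq> U \<and> smooth_on U Y \<and> (\<forall>p\<in>space_form \<rho>. Y p = X p) \<and>
        (\<forall>p\<in>space_form \<rho>. \<forall>u\<in>tangent \<rho> p. \<forall>v\<in>tangent \<rho> p.
           form \<rho> (covariant \<rho> p u (Y p) (frechet_derivative Y (at p) u)) v
         + form \<rho> u (covariant \<rho> p v (Y p) (frechet_derivative Y (at p) v)) = 0))"

definition flow_of :: "real \<Rightarrow> (real^4 \<Rightarrow> real^4) \<Rightarrow> (real \<Rightarrow> real^4 \<Rightarrow> real^4) \<Rightarrow> bool" where
  "flow_of \<rho> X \<phi> \<longleftrightarrow>
     (\<forall>p\<in>space_form \<rho>. \<phi> 0 p = p \<and>
        (\<forall>t. \<phi> t p \<in> space_form \<rho> \<and>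
             ((\<lambda>r. \<phi> r p) has_vector_derivative X (\<phi> t p)) (at t)))"

definition isometry :: "real \<Rightarrow> (real^4 \<Rightarrow> real^4) \<Rightarrow> bool" where
  "isometry \<rho> F \<longleftrightarrow>
     bij_betw F (space_form \<rho>) (space_form \<rho>) \<and>
     (\<forall>p\<in>space_form \<rho>. \<forall>q\<in>space_form \<rho>. geo_dist \<rho> (F p) (F q) = geo_dist \<rho> p q)"

text \<open>
  The derivative of \<open>F\<close> within the space form is unique on tangent vectors only, and only these
  are used.
\<close>

definition orientation_preserving :: "real \<Rightarrow> (real^4 \<Rightarrow> real^4) \<Rightarrow> bool" where
  "orientation_preserving \<rho> F \<longleftrightarrow>
     (\<forall>p\<in>space_form \<rho>. \<exists>D. (F has_derivative D) (at p within space_form \<rho>) \<and>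
        (\<forall>u\<in>tangent \<rho> p. \<forall>v\<in>tangent \<rho> p. \<forall>w\<in>tangent \<rho> p.
           vol \<rho> p u v w > 0 \<longrightarrow> vol \<rho> (F p) (D u) (D v) (D w) > 0))"

definition geodesic :: "real \<Rightarrow> (real^4) set \<Rightarrow> bool" where
  "geodesic \<rho> \<zeta> \<longleftrightarrow>
     (\<exists>c. arclength_curve \<rho> UNIV c \<and> (\<forall>t. covariant_along \<rho> c (velocity c) t = 0) \<and> \<zeta> = range c)"

text \<open>
  In dimension three, the orientation-preserving isometries fixing a geodesic pointwise are exactly
  the rotations about it.
\<close>

definition rotations :: "real \<Rightarrow> (real^4) set \<Rightarrow> (real^4 \<Rightarrow> real^4) set" where
  "rotations \<rho> \<zeta> = {F. isometry \<rho> F \<and> orientation_preserving \<rho> F \<and> (\<forall>p\<in>\<zeta>. F p = p)}"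

definition rotational_about :: "real \<Rightarrow> (real^4) set \<Rightarrow> (real^4) set \<Rightarrow> bool" where
  "rotational_about \<rho> \<zeta> S \<longleftrightarrow>
     geodesic \<rho> \<zeta> \<and> S \<subseteq> space_form \<rho> \<and> (\<forall>F\<in>rotations \<rho> \<zeta>. F ` S = S)"

text \<open>
  Orthogonality to the rotation: the curve is orthogonal to every velocity vector, at one of its
  points, of a curve that stays in the orbit of this point.
\<close>

definition profile_curve ::
    "real \<Rightarrow> (real^4) set \<Rightarrow> (real^4) set \<Rightarrow> real set \<Rightarrow> (real \<Rightarrow> real^4) \<Rightarrow> bool" where
  "profile_curve \<rho> \<zeta> S J \<gamma> \<longleftrightarrow>
     S = {F (\<gamma> s) | F s. F \<in> rotations \<rho> \<zeta> \<and> s \<in> J} \<and>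
     (\<forall>s\<in>J. \<forall>c c'. (\<forall>t. c t \<in> {F (\<gamma> s) | F. F \<in> rotations \<rho> \<zeta>}) \<and> c 0 = \<gamma> s \<and>
        (c has_vector_derivative c') (at 0) \<longrightarrow> form \<rho> c' (velocity \<gamma> s) = 0)"

section \<open>Immersed surfaces\<close>

text \<open>
  A surface is given by an immersion \<open>x\<close> of an open set \<open>U\<close> of parameters; tangent vectors of the
  surface at parameter \<open>q\<close> are represented by vectors of the parameter plane.
\<close>

abbreviation differential :: "('a::euclidean_space \<Rightarrow> 'b::euclidean_space) \<Rightarrow> 'a \<Rightarrow> 'a \<Rightarrow> 'b" where
  "differential f q \<equiv> frechet_derivative f (at q)"

definition immersed_surface :: "real \<Rightarrow> (real^2) set \<Rightarrow> (real^2 \<Rightarrow> real^4) \<Rightarrow> bool" where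
  "immersed_surface \<rho> U x \<longleftrightarrow>
     open U \<and> smooth_on U x \<and> (\<forall>q\<in>U. x q \<in> space_form \<rho> \<and> inj (differential x q))"

definition induced_metric :: "real \<Rightarrow> (real^2 \<Rightarrow> real^4) \<Rightarrow> real^2 \<Rightarrow> real^2 \<Rightarrow> real^2 \<Rightarrow> real" where
  "induced_metric \<rho> x q v w = form \<rho> (differential x q v) (differential x q w)"

definition unit_normal ::
    "real \<Rightarrow> (real^2) set \<Rightarrow> (real^2 \<Rightarrow> real^4) \<Rightarrow> (real^2 \<Rightarrow> real^4) \<Rightarrow> bool" where
  "unit_normal \<rho> U x \<eta> \<longleftrightarrow>
     smooth_on U \<eta> \<and>
     (\<forall>q\<in>U. \<eta> q \<in> tangent \<rho> (x q) \<and> form \<rho> (\<eta> q) (\<eta> q) = 1 \<and>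
        (\<forall>v. form \<rho> (\<eta> q) (differential x q v) = 0))"

definition shape_operator ::
    "real \<Rightarrow> (real^2 \<Rightarrow> real^4) \<Rightarrow> (real^2 \<Rightarrow> real^4) \<Rightarrow> real^2 \<Rightarrow> real^2 \<Rightarrow> real^2" where
  "shape_operator \<rho> x \<eta> q v =
     (THE w. differential x q w
               = - covariant \<rho> (x q) (differential x q v) (\<eta> q) (differential \<eta> q v))"

definition principal_curvatures ::
    "real \<Rightarrow> (real^2 \<Rightarrow> real^4) \<Rightarrow> (real^2 \<Rightarrow> real^4) \<Rightarrow> real^2 \<Rightarrow> real \<Rightarrow> real \<Rightarrow> bool" where
  "principal_curvatures \<rho> x \<eta> q k1 k2 \<longleftrightarrow>
     (\<exists>v w. induced_metric \<rho> x q v v = 1 \<and> induced_metric \<rho> x q w w = 1 \<and>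
        induced_metric \<rho> x q v w = 0 \<and>
        shape_operator \<rho> x \<eta> q v = k1 *\<^sub>R v \<and> shape_operator \<rho> x \<eta> q w = k2 *\<^sub>R w)"

definition linear_weingarten ::
    "real \<Rightarrow> (real^2) set \<Rightarrow> (real^2 \<Rightarrow> real^4) \<Rightarrow> (real^2 \<Rightarrow> real^4)
      \<Rightarrow> (real^2 \<Rightarrow> real) \<Rightarrow> (real^2 \<Rightarrow> real) \<Rightarrow> bool" where
  "linear_weingarten \<rho> U x \<eta> k1 k2 \<longleftrightarrow>
     (\<forall>q\<in>U. principal_curvatures \<rho> x \<eta> q (k1 q) (k2 q)) \<and> (\<exists>a. \<forall>q\<in>U. k1 q = a * k2 q)"

definition mean_curvature ::
    "real \<Rightarrow> (real^2 \<Rightarrow> real^4) \<Rightarrow> (real^2 \<Rightarrow> real^4) \<Rightarrow> real^2 \<Rightarrow> real" where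
  "mean_curvature \<rho> x \<eta> q = trace (matrix (shape_operator \<rho> x \<eta> q)) / 2"

definition surface_grad ::
    "real \<Rightarrow> (real^2 \<Rightarrow> real^4) \<Rightarrow> (real^2 \<Rightarrow> real) \<Rightarrow> real^2 \<Rightarrow> real^2" where
  "surface_grad \<rho> x h q = (THE w. \<forall>v. induced_metric \<rho> x q w v = differential h q v)"

definition biconservative ::
    "real \<Rightarrow> (real^2) set \<Rightarrow> (real^2 \<Rightarrow> real^4) \<Rightarrow> (real^2 \<Rightarrow> real^4) \<Rightarrow> bool" where
  "biconservative \<rho> U x \<eta> \<longleftrightarrow>
     (let H = mean_curvature \<rho> x \<eta> in
        \<forall>q\<in>U. 2 *\<^sub>R shape_operator \<rho> x \<eta> q (surface_grad \<rho> x H q)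
                + (2 * H q) *\<^sub>R surface_grad \<rho> x H q = 0)"

definition CMC :: "real \<Rightarrow> (real^2) set \<Rightarrow> (real^2 \<Rightarrow> real^4) \<Rightarrow> (real^2 \<Rightarrow> real^4) \<Rightarrow> bool" where
  "CMC \<rho> U x \<eta> \<longleftrightarrow> mean_curvature \<rho> x \<eta> constant_on U"

section \<open>The surface swept out by a curve under a flow\<close>

definition swept_surface ::
    "real set \<Rightarrow> (real \<Rightarrow> real^4) \<Rightarrow> (real \<Rightarrow> real^4 \<Rightarrow> real^4) \<Rightarrow> (real^4) set" where
  "swept_surface J \<gamma> \<phi> = {\<phi> t (\<gamma> s) | s t. s \<in> J}"

definition sweep_domain :: "real set \<Rightarrow> (real^2) set" where
  "sweep_domain J = {q. q$1 \<in> J}"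

definition sweep :: "(real \<Rightarrow> real^4) \<Rightarrow> (real \<Rightarrow> real^4 \<Rightarrow> real^4) \<Rightarrow> real^2 \<Rightarrow> real^4" where
  "sweep \<gamma> \<phi> q = \<phi> (q$2) (\<gamma> (q$1))"

end

theory Submission
  imports Defs
begin

text \<open>
  The binormal of a planar curve is a constant vector \<open>B0\<close> of the ambient space. A Killing field
  preserves distances infinitesimally, \<open>form \<rho> (X p - X q) (p - q) = 0\<close>; together with its values
  on the curve and the Euler--Lagrange equation this forces \<open>X p = \<beta> p *\<^sub>R B0 - \<alpha> p *\<^sub>R L\<close> for a
  constant vector \<open>L\<close> orthogonal to \<open>B0\<close> and affine functions \<open>\<alpha>\<close>, \<open>\<beta>\<close> with linear parts
  \<open>form \<rho> B0\<close>, \<open>form \<rho> L\<close>. Hence the flow moves the point \<open>\<gamma> s\<close>, where \<open>\<alpha> = 0\<close> and \<open>\<beta> = u / 4\<close>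
  with \<open>u = 1 / \<kappa> powr (3/4)\<close>, to \<open>\<gamma> s + (u s / 4) *\<^sub>R W t\<close>, where \<open>W\<close> solves a harmonic equation
  with constant \<open>m = form \<rho> L L\<close>, a sixteenth of the first integral. The two parameter directions
  are principal with curvatures \<open>- \<kappa>\<close> and \<open>3 * \<kappa>\<close>, so the mean curvature is \<open>\<kappa>\<close>, whose gradient
  lies in the first direction; this is the biconservative equation. If \<open>m > 0\<close>, the zeros of \<open>X\<close>
  form a geodesic, and the orbits are the sets of points at prescribed distances from its points.
\<close>


section \<open>Calculus of smooth maps\<close>

text \<open>The flow is given only by its differential equation, and \<open>X\<close> only by a
  first-order condition and its values on a curve. The way in is to fix one end \<open>y\<close> of
  a chord and let the other run along the curve: \<open>form \<rho> (X y) (\<gamma> s)\<close>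
  becomes a known function of \<open>s\<close>, whose first two derivatives give the components of
  \<open>X y\<close> along \<open>T\<close> and, through the Euler-Lagrange equation, along
  \<open>N\<close>. The binormal component stays open until chords between points at different
  heights \<open>\<alpha>\<close> are compared. The factor 3 of the second principal curvature is
  the 3 of the Euler-Lagrange equation: along an orbit the normal varies at the scale
  \<open>3 * \<kappa> s * u s / 4\<close>, the position at the scale \<open>u s / 4\<close>. The
  formulas have to serve all signs of \<open>\<rho>\<close> and of \<open>m\<close> at once; hence
  the generalised sine and versine, with parameter \<open>\<rho>\<close> on geodesics and
  \<open>m\<close> on orbits. Rotations about the axis are never classified: it is enough that they
  keep the distances to the points of the axis, and those that fill an orbit are written down
  explicitly.\<close>

lemma Ck_on_SucI:
  assumes "\<And>p. p \<in> U \<Longrightarrow> (f has_derivative f' p) (at p)" "\<And>v. Ck_on k U (\<lambda>p. f' p v)"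
  shows "Ck_on (Suc k) U f"
  using assms by auto

text \<open>\<open>Ck_on\<close> does not list the lower orders; they come back by induction,
  starting from continuity of differentiable maps. The product and chain rules need them for the
  factors left undifferentiated.\<close>

lemma Ck_on_Suc_imp: "Ck_on (Suc k) U f \<Longrightarrow> Ck_on k U f"
proof (induction k arbitrary: f)
  case 0
  then show ?case
    unfolding Ck_on.simps
    by (blast intro: continuous_at_imp_continuous_on has_derivative_continuous)
next
  case (Suc k)
  from Suc.prems obtain f' where f': "\<forall>p\<in>U. (f has_derivative f' p) (at p)"
    "\<And>v. Ck_on (Suc k) U (\<lambda>p. f' p v)"
    unfolding Ck_on.simps(2)[of "Suc k" U f] by blast
  show ?case
    by (rule Ck_on_SucI) (use f' Suc.IH in blast)+
qed

lemma Ck_on_cong: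
  assumes "open U" "\<And>p. p \<in> U \<Longrightarrow> f p = g p" "Ck_on k U f"
  shows "Ck_on k U g"
proof (cases k)
  case 0
  then show ?thesis using assms continuous_on_cong by auto
next
  case (Suc n)
  then obtain f' where f': "\<forall>p\<in>U. (f has_derivative f' p) (at p)" "\<And>v. Ck_on n U (\<lambda>p. f' p v)"
    using assms(3) by auto
  have "(g has_derivative f' p) (at p)" if "p \<in> U" for p
    using has_derivative_transform_within_open[of f "f' p" p UNIV U g] f'(1) that assms(1,2) by auto
  then show ?thesis unfolding Suc using f'(2) by (rule Ck_on_SucI)
qed

lemma Ck_on_const: "Ck_on k U (\<lambda>_. c)"
proof (induction k arbitrary: c)
  case (Suc k)
  show ?case by (rule Ck_on_SucI[where f' = "\<lambda>_ _. 0"]) (auto intro: Suc)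
qed simp

lemma Ck_on_bounded_linear:
  assumes "bounded_linear f"
  shows "Ck_on k U f"
proof (cases k)
  case 0
  then show ?thesis
    using assms by (simp add: linear_continuous_on)
next
  case (Suc n)
  show ?thesis unfolding Suc
    by (rule Ck_on_SucI[where f' = "\<lambda>_. f"])
       (auto intro: Ck_on_const bounded_linear_imp_has_derivative assms)
qed

lemma Ck_on_add: "Ck_on k U f \<Longrightarrow> Ck_on k U g \<Longrightarrow> Ck_on k U (\<lambda>p. f p + g p)"
proof (induction k arbitrary: f g)
  case 0
  then show ?case by (auto intro: continuous_intros)
next
  case (Suc k)
  obtain f' g' where f': "\<forall>p\<in>U. (f has_derivative f' p) (at p)" "\<And>v. Ck_on k U (\<lambda>p. f' p v)"
    and g': "\<forall>p\<in>U. (g has_derivative g' p) (at p)" "\<And>v. Ck_on k U (\<lambda>p. g' p v)"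
    using Suc.prems by auto
  show ?case
    by (rule Ck_on_SucI[where f' = "\<lambda>p v. f' p v + g' p v"])
       (auto intro!: has_derivative_add Suc.IH simp: f' g')
qed

lemma Ck_on_bilinear:
  assumes B: "bounded_bilinear bop"
  shows "Ck_on k U f \<Longrightarrow> Ck_on k U g \<Longrightarrow> Ck_on k U (\<lambda>p. bop (f p) (g p))"
proof (induction k arbitrary: f g)
  case 0
  then show ?case by (auto intro: bounded_bilinear.continuous_on[OF B])
next
  case (Suc k)
  obtain f' g' where f': "\<forall>p\<in>U. (f has_derivative f' p) (at p)" "\<And>v. Ck_on k U (\<lambda>p. f' p v)"
    and g': "\<forall>p\<in>U. (g has_derivative g' p) (at p)" "\<And>v. Ck_on k U (\<lambda>p. g' p v)"
    using Suc.prems by auto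
  have "Ck_on k U f" "Ck_on k U g"
    using Suc.prems Ck_on_Suc_imp by blast+
  then show ?case
    by (intro Ck_on_SucI[where f' = "\<lambda>p v. bop (f p) (g' p v) + bop (f' p v) (g p)"])
       (auto intro!: bounded_bilinear.FDERIV[OF B] Ck_on_add Suc.IH simp: f' g')
qed

text \<open>With a real inner function the outer derivative is only ever taken in the fixed
  direction 1, so the derivative of the composite is a product to which the induction hypothesis
  applies. For several variables the direction would vary with the point.\<close>

lemma Ck_on_compose_real:
  fixes h :: "real \<Rightarrow> 'c::euclidean_space"
  shows "Ck_on k V h \<Longrightarrow> Ck_on k U f \<Longrightarrow> f ` U \<subseteq> V \<Longrightarrow> Ck_on k U (\<lambda>p. h (f p))"
proof (induction k arbitrary: h)
  case 0
  then show ?case using continuous_on_compose2 by auto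
next
  case (Suc k)
  obtain f' h' where f': "\<forall>p\<in>U. (f has_derivative f' p) (at p)" "\<And>v. Ck_on k U (\<lambda>p. f' p v)"
    and h': "\<forall>p\<in>V. (h has_derivative h' p) (at p)" "\<And>v. Ck_on k V (\<lambda>p. h' p v)"
    using Suc.prems by auto
  have f: "Ck_on k U f"
    using Suc.prems Ck_on_Suc_imp by blast
  show ?case
  proof (rule Ck_on_SucI)
    show "((\<lambda>p. h (f p)) has_derivative (\<lambda>v. f' p v *\<^sub>R h' (f p) 1)) (at p)" if "p \<in> U" for p
    proof -
      have hd: "(h has_derivative h' (f p)) (at (f p))"
        using h' Suc.prems(3) that by blast
      interpret bounded_linear "h' (f p)"
        using hd by (rule has_derivative_bounded_linear)
      have "((\<lambda>p. h (f p)) has_derivative (\<lambda>v. h' (f p) (f' p v))) (at p)"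
        by (rule has_derivative_compose[where f = f and g = h]) (use f' that hd in auto)
      moreover have "h' (f p) (f' p v) = f' p v *\<^sub>R h' (f p) 1" for v
        using scaleR[of "f' p v" 1] by simp
      ultimately show ?thesis by simp
    qed
    show "Ck_on k U (\<lambda>p. f' p v *\<^sub>R h' (f p) 1)" for v
      by (rule Ck_on_bilinear[OF bounded_bilinear_scaleR f'(2)])
         (rule Suc.IH[OF h'(2) f Suc.prems(3)])
  qed
qed

lemma Ck_on_powr: "Ck_on k {0<..} (\<lambda>x::real. x powr a)"
proof (induction k arbitrary: a)
  case 0
  then show ?case by (auto intro!: continuous_intros)
next
  case (Suc k)
  show ?case
  proof (rule Ck_on_SucI)
    show "((\<lambda>x. x powr a) has_derivative (\<lambda>v. (a * v) * x powr (a - 1))) (at x)"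
      if "x \<in> {0<..}" for x :: real
      by (rule has_derivative_eq_rhs[OF has_real_derivative_powr[unfolded has_field_derivative_def]])
         (use that in \<open>auto simp: mult_ac\<close>)
    show "Ck_on k {0<..} (\<lambda>x. (a * v) * x powr (a - 1))" for v
      by (rule Ck_on_bilinear[OF bounded_bilinear_mult Ck_on_const Suc])
  qed
qed

lemma smooth_on_cong:
  "open U \<Longrightarrow> (\<And>p. p \<in> U \<Longrightarrow> f p = g p) \<Longrightarrow> smooth_on U f \<Longrightarrow> smooth_on U g"
  unfolding smooth_on_def using Ck_on_cong by blast

lemma smooth_on_const: "smooth_on U (\<lambda>_. c)"
  by (simp add: smooth_on_def Ck_on_const)

lemma smooth_on_bounded_linear: "bounded_linear f \<Longrightarrow> smooth_on U f"
  by (simp add: smooth_on_def Ck_on_bounded_linear)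

lemma smooth_on_add: "smooth_on U f \<Longrightarrow> smooth_on U g \<Longrightarrow> smooth_on U (\<lambda>p. f p + g p)"
  by (simp add: smooth_on_def Ck_on_add)

lemma smooth_on_bilinear:
  "bounded_bilinear bop \<Longrightarrow> smooth_on U f \<Longrightarrow> smooth_on U g \<Longrightarrow> smooth_on U (\<lambda>p. bop (f p) (g p))"
  by (simp add: smooth_on_def Ck_on_bilinear)

lemmas smooth_on_mult = smooth_on_bilinear[OF bounded_bilinear_mult]
lemmas smooth_on_scaleR = smooth_on_bilinear[OF bounded_bilinear_scaleR]

lemma smooth_on_minus: "smooth_on U f \<Longrightarrow> smooth_on U (\<lambda>p. - f p)"
  using smooth_on_scaleR[OF smooth_on_const[of U "-1"], of f] by simp

lemma smooth_on_diff: "smooth_on U f \<Longrightarrow> smooth_on U g \<Longrightarrow> smooth_on U (\<lambda>p. f p - g p)"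
  using smooth_on_add[OF _ smooth_on_minus, of U f g] by simp

lemma smooth_on_compose_real:
  fixes h :: "real \<Rightarrow> 'c::euclidean_space"
  shows "smooth_on V h \<Longrightarrow> smooth_on U f \<Longrightarrow> f ` U \<subseteq> V \<Longrightarrow> smooth_on U (\<lambda>p. h (f p))"
  unfolding smooth_on_def using Ck_on_compose_real by blast

lemma smooth_on_powr:
  fixes f :: "'a::euclidean_space \<Rightarrow> real"
  shows "smooth_on U f \<Longrightarrow> (\<And>p. p \<in> U \<Longrightarrow> 0 < f p) \<Longrightarrow> smooth_on U (\<lambda>p. f p powr a)"
  by (rule smooth_on_compose_real[where V = "{0<..}"]) (auto simp: smooth_on_def Ck_on_powr)

lemma smooth_on_has_derivative:
  assumes "smooth_on U f" "p \<in> U"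
  shows "(f has_derivative frechet_derivative f (at p)) (at p)"
proof -
  have "Ck_on (Suc 0) U f" using assms smooth_on_def by blast
  then obtain f' where "(f has_derivative f' p) (at p)" using assms(2) by auto
  then show ?thesis using differentiableI frechet_derivative_works by blast
qed

lemma smooth_on_has_vector_derivative:
  fixes f :: "real \<Rightarrow> 'b::euclidean_space"
  assumes "smooth_on J f" "s \<in> J"
  shows "(f has_vector_derivative vector_derivative f (at s)) (at s)"
  using smooth_on_has_derivative[OF assms] differentiableI vector_derivative_works by blast

lemma smooth_on_vector_derivative:
  fixes f :: "real \<Rightarrow> 'b::euclidean_space"
  assumes "smooth_on J f" "open J"
  shows "smooth_on J (\<lambda>s. vector_derivative f (at s))"
  unfolding smooth_on_def
proof
  fix k
  have "Ck_on (Suc k) J f" using assms smooth_on_def by blast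
  then obtain f' where f': "\<forall>p\<in>J. (f has_derivative f' p) (at p)" "\<And>v. Ck_on k J (\<lambda>p. f' p v)"
    by auto
  have "f' s 1 = vector_derivative f (at s)" if "s \<in> J" for s
  proof -
    have d: "(f has_derivative f' s) (at s)" using f' that by blast
    interpret bounded_linear "f' s" using d by (rule has_derivative_bounded_linear)
    have "f' s v = v *\<^sub>R f' s 1" for v
      using scaleR[of v 1] by simp
    then have "(f has_vector_derivative f' s 1) (at s)"
      unfolding has_vector_derivative_def using d by (metis (no_types, lifting) ext)
    then show ?thesis by (simp add: vector_derivative_at)
  qed
  then show "Ck_on k J (\<lambda>s. vector_derivative f (at s))"
    by (intro Ck_on_cong[OF assms(2) _ f'(2)[of 1]]) auto
qed

lemma smooth_on_real_derivative:
  fixes f :: "real \<Rightarrow> real"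
  assumes "smooth_on J f" "s \<in> J"
  shows "(f has_real_derivative deriv f s) (at s)"
proof -
  have "(f has_real_derivative vector_derivative f (at s)) (at s)"
    using smooth_on_has_vector_derivative[OF assms]
    by (simp add: has_real_derivative_iff_has_vector_derivative)
  then show ?thesis by (simp add: DERIV_imp_deriv)
qed

lemma smooth_on_deriv:
  fixes f :: "real \<Rightarrow> real"
  assumes "smooth_on J f" "open J"
  shows "smooth_on J (deriv f)"
proof (rule smooth_on_cong[OF assms(2) _ smooth_on_vector_derivative[OF assms]])
  fix s assume "s \<in> J"
  then show "vector_derivative f (at s) = deriv f s"
    using smooth_on_real_derivative[OF assms(1)]
    by (simp add: has_real_derivative_iff_has_vector_derivative vector_derivative_at)
qed

lemma vanishing_derivative_constant:
  fixes f :: "real \<Rightarrow> 'b::real_normed_vector"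
  assumes "is_interval J" "\<And>s. s \<in> J \<Longrightarrow> (f has_vector_derivative 0) (at s)" "s \<in> J" "t \<in> J"
  shows "f s = f t"
proof -
  have "\<exists>c. \<forall>x\<in>J. f x = c"
    by (rule has_vector_derivative_zero_constant[of J f])
       (auto intro: assms is_interval_convex has_vector_derivative_at_within)
  then show ?thesis using assms by metis
qed

section \<open>Generalised sine and versine\<close>

text \<open>The second unknown is the versine rather than the cosine \<open>1 - m * Q\<close>,
  because for \<open>m = 0\<close> the cosine is constant and no longer determines
  \<open>Q\<close>.\<close>

lemma generalised_sine_exists:
  fixes m :: real
  shows "\<exists>S Q. S 0 = 0 \<and> Q 0 = 0 \<and> (\<forall>t. (S has_real_derivative 1 - m * Q t) (at t)) \<and>
    (\<forall>t. (Q has_real_derivative S t) (at t))"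
proof (rule linorder_cases[of m 0])
  assume "m = 0"
  then show ?thesis
    by (intro exI[of _ "\<lambda>t. t"] exI[of _ "\<lambda>t. t\<^sup>2 / 2"]) (auto intro!: derivative_eq_intros)
next
  assume m: "m > 0"
  define w where "w = sqrt m"
  have w: "w > 0" "m = w\<^sup>2" using m by (auto simp: w_def)
  then show ?thesis
    by (intro exI[of _ "\<lambda>t. sin (w * t) / w"] exI[of _ "\<lambda>t. (1 - cos (w * t)) / w\<^sup>2"])
       (auto intro!: derivative_eq_intros simp: field_simps power2_eq_square)
next
  assume m: "m < 0"
  define w where "w = sqrt (- m)"
  have w: "w > 0" "m = - w\<^sup>2" using m by (auto simp: w_def)
  then show ?thesis
    by (intro exI[of _ "\<lambda>t. sinh (w * t) / w"] exI[of _ "\<lambda>t. (cosh (w * t) - 1) / w\<^sup>2"])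
       (auto intro!: derivative_eq_intros simp: field_simps power2_eq_square)
qed

text \<open>The solution of S'' = - m S with S(0) = 0 and S'(0) = 1: a sine, the identity or a
  hyperbolic sine, according to the sign of \<open>m\<close>.\<close>

definition gsin :: "real \<Rightarrow> real \<Rightarrow> real" where
  "gsin m = (SOME S. \<exists>Q. S 0 = 0 \<and> Q 0 = 0 \<and> (\<forall>t. (S has_real_derivative 1 - m * Q t) (at t)) \<and>
    (\<forall>t. (Q has_real_derivative S t) (at t)))"

text \<open>The integral of \<open>gsin m\<close>: (1 - cos) / m in the trigonometric case, half the
  square of the parameter for \<open>m = 0\<close>. The generalised cosine appears throughout as
  \<open>1 - m * gver m t\<close>.\<close>

definition gver :: "real \<Rightarrow> real \<Rightarrow> real" where
  "gver m = (SOME Q. gsin m 0 = 0 \<and> Q 0 = 0 \<and>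
    (\<forall>t. (gsin m has_real_derivative 1 - m * Q t) (at t)) \<and>
    (\<forall>t. (Q has_real_derivative gsin m t) (at t)))"

lemma gsin_gver:
  "gsin m 0 = 0 \<and> gver m 0 = 0 \<and> (\<forall>t. (gsin m has_real_derivative 1 - m * gver m t) (at t)) \<and>
    (\<forall>t. (gver m has_real_derivative gsin m t) (at t))"
proof -
  have "\<exists>Q. gsin m 0 = 0 \<and> Q 0 = 0 \<and> (\<forall>t. (gsin m has_real_derivative 1 - m * Q t) (at t)) \<and>
    (\<forall>t. (Q has_real_derivative gsin m t) (at t))"
    unfolding gsin_def by (rule someI_ex[OF generalised_sine_exists])
  then show ?thesis
    unfolding gver_def by (rule someI_ex)
qed

lemma gsin_zero [simp]: "gsin m 0 = 0" and gver_zero [simp]: "gver m 0 = 0"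
  using gsin_gver by auto

lemma gsin_derivative: "(gsin m has_real_derivative 1 - m * gver m t) (at t)"
  and gver_derivative: "(gver m has_real_derivative gsin m t) (at t)"
  using gsin_gver by auto

text \<open>The Pythagorean identity divided by \<open>m\<close>, which keeps its content for
  \<open>m = 0\<close>. The difference of the two sides has derivative zero.\<close>

lemma gsin_gver_conic: "(gsin m t)\<^sup>2 + m * (gver m t)\<^sup>2 = 2 * gver m t"
proof -
  let ?f = "\<lambda>t. (gsin m t)\<^sup>2 + m * (gver m t)\<^sup>2 - 2 * gver m t"
  have "(?f has_real_derivative 0) (at t)" for t
    by (auto intro!: derivative_eq_intros gsin_derivative gver_derivative simp: algebra_simps)
  then have "?f t = ?f 0"
    using DERIV_isconst_all by blast
  then show ?thesis by simp
qed

lemma gcos_gsin_squared: "(1 - m * gver m t)\<^sup>2 + m * (gsin m t)\<^sup>2 = 1"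
proof -
  have "m * ((gsin m t)\<^sup>2 + m * (gver m t)\<^sup>2) = m * (2 * gver m t)"
    using gsin_gver_conic by simp
  then show ?thesis by (simp add: algebra_simps power2_eq_square)
qed

text \<open>The pair of \<open>\<alpha>\<close> and \<open>\<beta>\<close>, multiplied by the
  inverse of the fundamental matrix of the system, is constant; facts \<open>1\<close> and
  \<open>2\<close> are its two components, and the Pythagorean identity undoes the
  multiplication.\<close>

lemma harmonic_unique:
  fixes \<alpha> \<beta> :: "real \<Rightarrow> real"
  assumes \<alpha>: "\<And>t. (\<alpha> has_real_derivative \<beta> t) (at t)"
    and \<beta>: "\<And>t. (\<beta> has_real_derivative - m * \<alpha> t) (at t)"
    and "\<alpha> 0 = 0"
  shows "\<alpha> t = \<beta> 0 * gsin m t" "\<beta> t = \<beta> 0 * (1 - m * gver m t)"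
proof -
  let ?S = "gsin m" and ?C = "\<lambda>t. 1 - m * gver m t"
  have "((\<lambda>t. \<alpha> t * ?C t - \<beta> t * ?S t) has_real_derivative 0) (at t)" for t
    by (auto intro!: derivative_eq_intros \<alpha> \<beta> gsin_derivative gver_derivative simp: algebra_simps)
  then have 1: "\<alpha> t * ?C t - \<beta> t * ?S t = 0"
    using DERIV_isconst_all[of "\<lambda>t. \<alpha> t * ?C t - \<beta> t * ?S t" t 0] assms(3) by simp
  have "((\<lambda>t. m * \<alpha> t * ?S t + \<beta> t * ?C t) has_real_derivative 0) (at t)" for t
    by (auto intro!: derivative_eq_intros \<alpha> \<beta> gsin_derivative gver_derivative simp: algebra_simps)
  then have 2: "m * \<alpha> t * ?S t + \<beta> t * ?C t = \<beta> 0"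
    using DERIV_isconst_all[of "\<lambda>t. m * \<alpha> t * ?S t + \<beta> t * ?C t" t 0] assms(3) by simp
  have "\<alpha> t * ((?C t)\<^sup>2 + m * (?S t)\<^sup>2) =
      (\<alpha> t * ?C t - \<beta> t * ?S t) * ?C t + (m * \<alpha> t * ?S t + \<beta> t * ?C t) * ?S t"
    by (simp add: algebra_simps power2_eq_square)
  then show "\<alpha> t = \<beta> 0 * ?S t"
    by (simp add: 1 2 gcos_gsin_squared)
  have "\<beta> t * ((?C t)\<^sup>2 + m * (?S t)\<^sup>2) =
      (m * \<alpha> t * ?S t + \<beta> t * ?C t) * ?C t - m * (\<alpha> t * ?C t - \<beta> t * ?S t) * ?S t"
    by (simp add: algebra_simps power2_eq_square)
  then show "\<beta> t = \<beta> 0 * ?C t"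
    by (simp add: 1 2 gcos_gsin_squared)
qed

text \<open>The right-hand sides solve the same initial value problem. The second formula shows that
  the versine is nonnegative; both together give the rotations of the last section square
  roots.\<close>

lemma gsin_gver_half:
  "gsin m t = 2 * gsin m (t / 2) * (1 - m * gver m (t / 2))"
  "gver m t = 2 * (gsin m (t / 2))\<^sup>2"
proof -
  note [derivative_intros] = DERIV_chain2[OF gsin_derivative] DERIV_chain2[OF gver_derivative]
  define \<alpha> where "\<alpha> t = 2 * gsin m (t / 2) * (1 - m * gver m (t / 2))" for t
  define f where "f t = 2 * (gsin m (t / 2))\<^sup>2" for t
  have f: "(f has_real_derivative \<alpha> t) (at t)" for t
    unfolding f_def \<alpha>_def by (auto intro!: derivative_eq_intros)
  have "(\<alpha> has_real_derivative (1 - m * gver m (t / 2))\<^sup>2 - m * (gsin m (t / 2))\<^sup>2) (at t)" for t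
    unfolding \<alpha>_def by (auto intro!: derivative_eq_intros simp: power2_eq_square algebra_simps)
  moreover have "(1 - m * gver m (t / 2))\<^sup>2 - m * (gsin m (t / 2))\<^sup>2 = 1 - m * f t" for t
    using gcos_gsin_squared[of m "t / 2"] by (simp add: f_def)
  ultimately have a: "(\<alpha> has_real_derivative 1 - m * f t) (at t)" for t by simp
  have b: "((\<lambda>t. 1 - m * f t) has_real_derivative - m * \<alpha> t) (at t)" for t
    by (auto intro!: derivative_eq_intros f)
  have \<alpha>: "\<alpha> t = gsin m t" for t
    using harmonic_unique(1)[OF a b] by (simp add: \<alpha>_def f_def)
  then show "gsin m t = 2 * gsin m (t / 2) * (1 - m * gver m (t / 2))"
    by (simp add: \<alpha>_def)
  have "((\<lambda>t. f t - gver m t) has_real_derivative 0) (at t)" for t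
    by (auto intro!: derivative_eq_intros f gver_derivative simp: \<alpha>)
  then have "f t - gver m t = f 0 - gver m 0"
    using DERIV_isconst_all[of "\<lambda>t. f t - gver m t" t 0] by blast
  then show "gver m t = 2 * (gsin m (t / 2))\<^sup>2"
    by (simp add: f_def)
qed

text \<open>Parametrisation of a conic. For \<open>m \<le> 0\<close> the conic has two branches, and
  the curve through (1, 0) stays on the one with positive \<open>c\<close>; for \<open>m > 0\<close>
  it is an ellipse and is covered entirely.\<close>

lemma gsin_gver_attain:
  assumes "c\<^sup>2 + m * x\<^sup>2 = 1" "m \<le> 0 \<Longrightarrow> 0 < c"
  shows "\<exists>t. gsin m t = x \<and> 1 - m * gver m t = c"
proof (rule linorder_cases[of m 0])
  assume m: "m = 0"
  have "gsin m t = t" for t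
    using harmonic_unique(1)[of "\<lambda>t. t" "\<lambda>_. 1" m t] m by (auto intro!: derivative_eq_intros)
  then show ?thesis using assms m by (auto simp: power2_eq_1_iff)
next
  assume m: "m > 0"
  define w where "w = sqrt m"
  have w: "w > 0" "m = w\<^sup>2" using m by (auto simp: w_def)
  have 1: "((\<lambda>t. sin (w * t) / w) has_real_derivative cos (w * t)) (at t)" for t
    using w by (auto intro!: derivative_eq_intros)
  have 2: "((\<lambda>t. cos (w * t)) has_real_derivative - m * (sin (w * t) / w)) (at t)" for t
    using w by (auto intro!: derivative_eq_intros simp: power2_eq_square)
  obtain y where "c = cos y" "w * x = sin y"
    using sincos_total_2pi[of c "w * x"] assms(1) w(2) by (metis power_mult_distrib)
  then show ?thesis
    using harmonic_unique[OF 1 2, of "y / w"] w by (intro exI[of _ "y / w"]) (auto simp: field_simps)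
next
  assume m: "m < 0"
  define w where "w = sqrt (- m)"
  have w: "w > 0" "m = - w\<^sup>2" using m by (auto simp: w_def)
  have 1: "((\<lambda>t. sinh (w * t) / w) has_real_derivative cosh (w * t)) (at t)" for t
    using w by (auto intro!: derivative_eq_intros)
  have 2: "((\<lambda>t. cosh (w * t)) has_real_derivative - m * (sinh (w * t) / w)) (at t)" for t
    using w by (auto intro!: derivative_eq_intros simp: power2_eq_square)
  define y where "y = arsinh (w * x)"
  have y: "sinh y = w * x" by (simp add: y_def)
  have "(cosh y)\<^sup>2 = c\<^sup>2"
    using assms(1) w by (simp add: cosh_square_eq y power_mult_distrib)
  then have "cosh y = c"
    unfolding power2_eq_iff using assms(2) m cosh_real_pos[of y] by linarith
  then show ?thesis
    using harmonic_unique[OF 1 2, of "y / w"] w y by (intro exI[of _ "y / w"]) (auto simp: field_simps)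
qed

lemma Ck_on_gsin_gver: "Ck_on k UNIV (gsin m) \<and> Ck_on k UNIV (gver m)"
proof (induction k)
  case 0
  have "continuous_on UNIV (gsin m)" "continuous_on UNIV (gver m)"
    using gsin_derivative gver_derivative DERIV_continuous
    by (blast intro: continuous_at_imp_continuous_on)+
  then show ?case by simp
next
  case (Suc k)
  have "Ck_on (Suc k) UNIV (gsin m)"
  proof (rule Ck_on_SucI)
    show "(gsin m has_derivative (\<lambda>v. v * (1 + (- m) * gver m t))) (at t)" for t
      using gsin_derivative[of m t] by (simp add: has_field_derivative_def mult.commute[of _ "_ - _"])
    show "Ck_on k UNIV (\<lambda>t. v * (1 + (- m) * gver m t))" for v
      by (intro Ck_on_bilinear[OF bounded_bilinear_mult] Ck_on_const Ck_on_add conjunct2[OF Suc])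
  qed
  moreover have "Ck_on (Suc k) UNIV (gver m)"
  proof (rule Ck_on_SucI)
    show "(gver m has_derivative (\<lambda>v. v * gsin m t)) (at t)" for t
      using gver_derivative[of m t] by (simp add: has_field_derivative_def mult.commute[of _ "gsin m t"])
    show "Ck_on k UNIV (\<lambda>t. v * gsin m t)" for v
      by (intro Ck_on_bilinear[OF bounded_bilinear_mult] Ck_on_const conjunct1[OF Suc])
  qed
  ultimately show ?case by blast
qed

lemma smooth_on_gsin: "smooth_on UNIV (gsin m)" and smooth_on_gver: "smooth_on UNIV (gver m)"
  by (simp_all add: smooth_on_def Ck_on_gsin_gver)


section \<open>The ambient form and orthonormal frames\<close>

abbreviation form_sign :: "real \<Rightarrow> real" where
  "form_sign \<rho> \<equiv> (if \<rho> < 0 then - 1 else 1)"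

lemma form_commute: "form \<rho> x y = form \<rho> y x"
  by (simp add: form_def mult.commute)

lemma form_linear [simp]:
  "form \<rho> (x + y) z = form \<rho> x z + form \<rho> y z" "form \<rho> z (x + y) = form \<rho> z x + form \<rho> z y"
  "form \<rho> (x - y) z = form \<rho> x z - form \<rho> y z" "form \<rho> z (x - y) = form \<rho> z x - form \<rho> z y"
  "form \<rho> (- x) z = - form \<rho> x z" "form \<rho> z (- x) = - form \<rho> z x"
  "form \<rho> (c *\<^sub>R x) z = c * form \<rho> x z" "form \<rho> z (c *\<^sub>R x) = c * form \<rho> z x"
  "form \<rho> 0 z = 0" "form \<rho> z 0 = 0"
  by (simp_all add: form_def algebra_simps)

lemma bounded_bilinear_form: "bounded_bilinear (form \<rho>)"
proof
  show "\<exists>K. \<forall>a b. norm (form \<rho> a b) \<le> norm a * norm b * K"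
  proof (intro exI allI)
    fix a b :: "real^4"
    have c: "\<bar>a $ i * b $ i\<bar> \<le> norm a * norm b" for i
      unfolding abs_mult by (intro mult_mono component_le_norm_cart) auto
    have "\<bar>form \<rho> a b\<bar> \<le> \<bar>a$1 * b$1\<bar> + \<bar>a$2 * b$2\<bar> + \<bar>a$3 * b$3\<bar> + \<bar>a$4 * b$4\<bar>"
      unfolding form_def by auto
    also have "\<dots> \<le> norm a * norm b * 4"
      using c[of 1] c[of 2] c[of 3] c[of 4] by linarith
    finally show "norm (form \<rho> a b) \<le> norm a * norm b * 4" by simp
  qed
qed auto

lemmas smooth_on_form = smooth_on_bilinear[OF bounded_bilinear_form]

lemma form_has_derivative:
  fixes f g :: "real \<Rightarrow> real^4"
  assumes "(f has_vector_derivative f') (at t)" "(g has_vector_derivative g') (at t)"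
  shows "((\<lambda>t. form \<rho> (f t) (g t)) has_real_derivative form \<rho> (f t) g' + form \<rho> f' (g t)) (at t)"
  using bounded_bilinear.has_vector_derivative[OF bounded_bilinear_form assms]
  by (simp add: has_real_derivative_iff_has_vector_derivative)

lemma form_const_has_derivative:
  fixes f :: "real \<Rightarrow> real^4"
  assumes "(f has_vector_derivative f') (at t)"
  shows "((\<lambda>t. form \<rho> a (f t)) has_real_derivative form \<rho> a f') (at t)"
  using form_has_derivative[OF has_vector_derivative_const assms, of \<rho> a] by simp

lemma form_axis: "form \<rho> v (axis i 1) = (if i = 4 then form_sign \<rho> else 1) * v $ i"
  using exhaust_4[of i] by (auto simp: form_def axis_def)

lemma form_nondegenerate:
  assumes "\<And>w. form \<rho> v w = 0"
  shows "v = 0"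
proof -
  have "v $ i = 0" for i
    using assms[of "axis i 1"] by (simp add: form_axis split: if_splits)
  then show ?thesis by (simp add: vec_eq_iff)
qed

lemma form_square_pos: "0 \<le> \<rho> \<Longrightarrow> v \<noteq> 0 \<Longrightarrow> 0 < form \<rho> v v"
proof -
  assume "0 \<le> \<rho>" "v \<noteq> 0"
  then have "form \<rho> v v = v \<bullet> v"
    by (simp add: form_def inner_vec_def sum_4)
  then show ?thesis using \<open>v \<noteq> 0\<close> by simp
qed

text \<open>Pairwise orthogonal vectors with nonzero squares are independent, hence span by
  dimension. Unit squares would be too narrow: the conormal has square -1 for
  \<open>\<rho> < 0\<close>, and frames containing \<open>L\<close>, of square \<open>m\<close>,
  occur later.\<close>

lemma orthogonal_to_frame:
  assumes orth: "form \<rho> a b = 0" "form \<rho> a c = 0" "form \<rho> a d = 0"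
      "form \<rho> b c = 0" "form \<rho> b d = 0" "form \<rho> c d = 0"
    and nonnull: "form \<rho> a a \<noteq> 0" "form \<rho> b b \<noteq> 0" "form \<rho> c c \<noteq> 0" "form \<rho> d d \<noteq> 0"
    and v: "form \<rho> v a = 0" "form \<rho> v b = 0" "form \<rho> v c = 0" "form \<rho> v d = 0"
  shows "v = 0"
proof (rule form_nondegenerate)
  fix w
  define f where "f y = y$1 *\<^sub>R a + y$2 *\<^sub>R b + y$3 *\<^sub>R c + y$4 *\<^sub>R d" for y :: "real^4"
  have lin: "linear f"
    by (rule linearI) (simp_all add: f_def algebra_simps)
  have "y = 0" if "f y = 0" for y
  proof -
    have "form \<rho> (f y) a = y$1 * form \<rho> a a" "form \<rho> (f y) b = y$2 * form \<rho> b b"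
      "form \<rho> (f y) c = y$3 * form \<rho> c c" "form \<rho> (f y) d = y$4 * form \<rho> d d"
      using orth by (simp_all add: f_def form_commute[of \<rho> b a] form_commute[of \<rho> c a]
          form_commute[of \<rho> d a] form_commute[of \<rho> c b] form_commute[of \<rho> d b] form_commute[of \<rho> d c])
    then show ?thesis using that nonnull by (simp add: vec_eq_iff forall_4)
  qed
  then have "inj f" using linear_injective_0[OF lin] by blast
  then have "surj f" using linear_injective_imp_surjective[OF lin] by simp
  then obtain y where "w = f y" by auto
  then show "form \<rho> v w = 0" using v by (simp add: f_def)
qed

section \<open>The volume form and the cross product\<close>

lemma det_4:
  "det (vector [u, v, w, n] :: real^4^4) =
    u$1 * (v$2 * (w$3 * n$4 - w$4 * n$3) - v$3 * (w$2 * n$4 - w$4 * n$2) + v$4 * (w$2 * n$3 - w$3 * n$2))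
  - u$2 * (v$1 * (w$3 * n$4 - w$4 * n$3) - v$3 * (w$1 * n$4 - w$4 * n$1) + v$4 * (w$1 * n$3 - w$3 * n$1))
  + u$3 * (v$1 * (w$2 * n$4 - w$4 * n$2) - v$2 * (w$1 * n$4 - w$4 * n$1) + v$4 * (w$1 * n$2 - w$2 * n$1))
  - u$4 * (v$1 * (w$2 * n$3 - w$3 * n$2) - v$2 * (w$1 * n$3 - w$3 * n$1) + v$3 * (w$1 * n$2 - w$2 * n$1))"
proof -
  have f1234: "finite {2::4, 3, 4}" "1 \<notin> {2::4, 3, 4}"
    and f234: "finite {3::4, 4}" "2 \<notin> {3::4, 4}"
    and f34: "finite {4::4}" "3 \<notin> {4::4}"
    by auto
  have vec: "(vector [u, v, w, n] :: real^4^4) $ 1 = u" "(vector [u, v, w, n] :: real^4^4) $ 2 = v"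
    "(vector [u, v, w, n] :: real^4^4) $ 3 = w" "(vector [u, v, w, n] :: real^4^4) $ 4 = n"
    unfolding vector_def by simp_all
  show ?thesis
    unfolding det_def UNIV_4
    unfolding sum_over_permutations_insert[OF f1234]
    unfolding sum_over_permutations_insert[OF f234]
    unfolding sum_over_permutations_insert[OF f34]
    unfolding permutes_sing
    apply (simp add: sign_swap_id sign_id sign_compose permutation_compose permutation_swap_id
        vec transpose_def)
    apply (simp add: algebra_simps)
    done
qed

lemma form_cross: "form \<rho> (cross \<rho> p u v) w = vol \<rho> p u v w"
  by (simp add: form_def cross_def vol_def det_4 axis_def algebra_simps)

lemma vol_degenerate: "vol \<rho> p u v u = 0" "vol \<rho> p u v v = 0" "vol \<rho> p u v (conormal \<rho> p) = 0"
  by (simp_all add: vol_def det_4 algebra_simps)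

text \<open>The bracket is the Gram determinant of \<open>u\<close>, \<open>v\<close> and the
  conormal; the sign in front is the determinant of the form itself.\<close>

lemma form_cross_self:
  fixes \<rho> :: real and p u v :: "real^4"
  defines "n \<equiv> conormal \<rho> p"
  shows "form \<rho> (cross \<rho> p u v) (cross \<rho> p u v) = form_sign \<rho> *
    (form \<rho> u u * (form \<rho> v v * form \<rho> n n - (form \<rho> v n)\<^sup>2)
     - form \<rho> u v * (form \<rho> u v * form \<rho> n n - form \<rho> v n * form \<rho> u n)
     + form \<rho> u n * (form \<rho> u v * form \<rho> v n - form \<rho> v v * form \<rho> u n))"
proof -
  have c: "cross \<rho> p u v $ 1 = vol \<rho> p u v (axis 1 1)" "cross \<rho> p u v $ 2 = vol \<rho> p u v (axis 2 1)"
    "cross \<rho> p u v $ 3 = vol \<rho> p u v (axis 3 1)"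
    "cross \<rho> p u v $ 4 = form_sign \<rho> * vol \<rho> p u v (axis 4 1)"
    by (simp_all add: cross_def)
  show ?thesis
  proof (cases "\<rho> < 0")
    case True
    then show ?thesis
      unfolding form_def c
      by (simp add: vol_def det_4 axis_def flip: n_def) algebra
  next
    case False
    then show ?thesis
      unfolding form_def c
      by (simp add: vol_def det_4 axis_def flip: n_def) algebra
  qed
qed

lemma smooth_on_coordinate:
  fixes f :: "'a::euclidean_space \<Rightarrow> real^'n"
  assumes "smooth_on U f"
  shows "smooth_on U (\<lambda>s. f s $ i)"
  using smooth_on_bilinear[OF bounded_bilinear_inner assms smooth_on_const[of U "axis i 1"]]
  by (simp add: inner_axis)

lemma smooth_on_vec:
  fixes f :: "'a::euclidean_space \<Rightarrow> real^4"
  assumes "\<And>i. smooth_on U (\<lambda>s. f s $ i)"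
  shows "smooth_on U f"
proof -
  have "f = (\<lambda>s. f s $ 1 *\<^sub>R axis 1 1 + f s $ 2 *\<^sub>R axis 2 1 + f s $ 3 *\<^sub>R axis 3 1 + f s $ 4 *\<^sub>R axis 4 1)"
    by (simp add: fun_eq_iff vec_eq_iff forall_4 axis_def)
  moreover have "smooth_on U \<dots>"
    by (intro smooth_on_add smooth_on_scaleR smooth_on_const assms)
  ultimately show ?thesis by simp
qed

lemma smooth_on_conormal:
  assumes "smooth_on U x"
  shows "smooth_on U (\<lambda>s. conormal \<rho> (x s))"
  using assms unfolding conormal_def
  by (cases "\<rho> = 0") (simp_all add: smooth_on_const smooth_on_scaleR)

lemma smooth_on_cross:
  assumes "smooth_on U x" "smooth_on U f" "smooth_on U g"
  shows "smooth_on U (\<lambda>s. cross \<rho> (x s) (f s) (g s))"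
proof (rule smooth_on_vec)
  fix i
  have "smooth_on U (\<lambda>s. (if \<rho> < 0 \<and> i = 4 then - 1 else 1) * vol \<rho> (x s) (f s) (g s) (axis i 1))"
    unfolding vol_def det_4
    by (intro smooth_on_mult smooth_on_add smooth_on_diff smooth_on_const smooth_on_coordinate
        smooth_on_conormal assms)
  then show "smooth_on U (\<lambda>s. cross \<rho> (x s) (f s) (g s) $ i)"
    by (simp add: cross_def)
qed

section \<open>Points and tangent vectors of the space form\<close>

lemma conormal_square: "p \<in> space_form \<rho> \<Longrightarrow> form \<rho> (conormal \<rho> p) (conormal \<rho> p) = form_sign \<rho>"
  by (auto simp: space_form_def conormal_def form_axis split: if_splits)

text \<open>A description of the tangent space common to the three models, so that frame arguments
  run without distinguishing the sign of \<open>\<rho>\<close>.\<close>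

lemma tangent_iff_conormal: "v \<in> tangent \<rho> p \<longleftrightarrow> form \<rho> v (conormal \<rho> p) = 0"
  by (auto simp: tangent_def conormal_def form_axis)

lemma space_form_norm: "p \<in> space_form \<rho> \<Longrightarrow> \<rho> \<noteq> 0 \<Longrightarrow> \<rho> * form \<rho> p p = 1"
  by (auto simp: space_form_def split: if_splits)

lemma space_form_flat: "p \<in> space_form 0 \<longleftrightarrow> p $ 4 = 1"
  by (simp add: space_form_def)

lemma cauchy_schwarz_3:
  "(p$1 * q$1 + p$2 * q$2 + p$3 * q$3)\<^sup>2 \<le>
    ((p$1)\<^sup>2 + (p$2)\<^sup>2 + (p$3)\<^sup>2) * ((q$1)\<^sup>2 + (q$2)\<^sup>2 + (q$3)\<^sup>2)" for p q :: "real^4"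
proof -
  have "0 \<le> (p$1 * q$2 - p$2 * q$1)\<^sup>2 + (p$1 * q$3 - p$3 * q$1)\<^sup>2 + (p$2 * q$3 - p$3 * q$2)\<^sup>2"
    by simp
  then show ?thesis by (simp add: power2_eq_square algebra_simps)
qed

text \<open>The point \<open>p\<close> lies inside the light cone, so its spatial part is shorter
  than \<open>p$4\<close>. Orthogonality and Cauchy-Schwarz on the spatial parts then bound the
  fourth coordinate of \<open>v\<close> strictly by its spatial part.\<close>

lemma hyperbolic_spacelike:
  assumes "\<rho> < 0" "p \<in> space_form \<rho>" "form \<rho> v p = 0" "v \<noteq> 0"
  shows "0 < form \<rho> v v"
proof -
  let ?P = "(p$1)\<^sup>2 + (p$2)\<^sup>2 + (p$3)\<^sup>2" and ?V = "(v$1)\<^sup>2 + (v$2)\<^sup>2 + (v$3)\<^sup>2"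
  have P: "(p$4)\<^sup>2 = ?P + 1 / (- \<rho>)" "p$4 > 0"
    using assms by (auto simp: space_form_def form_def power2_eq_square)
  then have lt: "?P < (p$4)\<^sup>2" using assms(1) by simp
  have o: "v$4 * p$4 = v$1 * p$1 + v$2 * p$2 + v$3 * p$3"
    using assms by (simp add: form_def)
  have V: "0 < ?V"
  proof (rule ccontr)
    assume "\<not> 0 < ?V"
    then have "?V = 0" by (smt (verit) zero_le_power2)
    then have "v$1 = 0 \<and> v$2 = 0 \<and> v$3 = 0" by (smt (verit) zero_le_power2 zero_eq_power2)
    moreover from this o P(2) have "v$4 = 0" by simp
    ultimately show False using assms(4) by (simp add: vec_eq_iff forall_4)
  qed
  have "(v$4)\<^sup>2 * (p$4)\<^sup>2 \<le> ?V * ?P"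
    using cauchy_schwarz_3[of v p] o by (simp flip: power_mult_distrib)
  also have "\<dots> < ?V * (p$4)\<^sup>2"
    using V lt by simp
  finally have "(v$4)\<^sup>2 < ?V"
    using P(2) by simp
  then show ?thesis
    using assms(1) by (simp add: form_def power2_eq_square)
qed

lemma tangent_positive:
  assumes "p \<in> space_form \<rho>" "v \<in> tangent \<rho> p" "v \<noteq> 0"
  shows "0 < form \<rho> v v"
  using assms hyperbolic_spacelike form_square_pos
  by (cases "\<rho> < 0") (auto simp: tangent_def)

text \<open>The reversed Cauchy-Schwarz inequality for two vectors on one sheet, obtained from the
  Euclidean one for the spatial parts. It puts the argument of \<open>arcosh\<close> in the range
  where this function is injective.\<close>

lemma hyperbolic_form_ge:
  assumes "\<rho> < 0" "p \<in> space_form \<rho>" "q \<in> space_form \<rho>"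
  shows "1 \<le> \<rho> * form \<rho> p q"
proof -
  let ?P = "(p$1)\<^sup>2 + (p$2)\<^sup>2 + (p$3)\<^sup>2" and ?Q = "(q$1)\<^sup>2 + (q$2)\<^sup>2 + (q$3)\<^sup>2"
  let ?i = "p$1 * q$1 + p$2 * q$2 + p$3 * q$3"
  define R where "R = 1 / (- \<rho>)"
  have R: "R > 0" using assms(1) by (simp add: R_def)
  have P: "(p$4)\<^sup>2 = ?P + R" "p$4 > 0" and Q: "(q$4)\<^sup>2 = ?Q + R" "q$4 > 0"
    using assms by (auto simp: space_form_def form_def power2_eq_square R_def)
  have amgm: "2 * ?i \<le> ?P + ?Q"
    using zero_le_power2[of "p$1 - q$1"] zero_le_power2[of "p$2 - q$2"] zero_le_power2[of "p$3 - q$3"]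
    by (simp add: power2_eq_square algebra_simps)
  have "(?i + R)\<^sup>2 = ?i\<^sup>2 + 2 * ?i * R + R\<^sup>2"
    by (simp add: power2_eq_square algebra_simps)
  also have "\<dots> \<le> ?P * ?Q + (?P + ?Q) * R + R\<^sup>2"
    using R by (intro add_mono cauchy_schwarz_3 mult_right_mono amgm) auto
  also have "\<dots> = (p$4 * q$4)\<^sup>2"
    unfolding power_mult_distrib P(1) Q(1) by (simp add: power2_eq_square algebra_simps)
  finally have "?i + R \<le> p$4 * q$4"
    by (rule power2_le_imp_le) (use P(2) Q(2) in \<open>simp add: mult_nonneg_nonneg less_imp_le\<close>)
  then have "R \<le> - form \<rho> p q"
    using assms(1) by (simp add: form_def)
  then show ?thesis
    using assms(1) by (simp add: R_def field_simps)
qed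

text \<open>Replaces the sign of the fourth coordinate by the sign of a product with a known point,
  which is preserved by maps that preserve the form and fix that point. On the wrong sheet,
  \<open>- p\<close> would violate the reversed Cauchy-Schwarz inequality.\<close>

lemma hyperbolic_same_sheet:
  assumes "\<rho> < 0" "q \<in> space_form \<rho>" "form \<rho> p p = 1 / \<rho>" "form \<rho> p q < 0"
  shows "p \<in> space_form \<rho>"
proof -
  have "p$4 \<noteq> 0"
  proof
    assume "p$4 = 0"
    then have "form \<rho> p p = (p$1)\<^sup>2 + (p$2)\<^sup>2 + (p$3)\<^sup>2" by (simp add: form_def power2_eq_square)
    moreover have "1 / \<rho> < 0" using assms(1) by simp
    ultimately show False using assms(3) by (smt (verit) zero_le_power2)
  qed
  moreover have "\<not> p$4 < 0"
  proof
    assume "p$4 < 0"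
    then have "- p \<in> space_form \<rho>"
      using assms by (simp add: space_form_def)
    from hyperbolic_form_ge[OF assms(1) this assms(2)] have "1 \<le> - (\<rho> * form \<rho> p q)" by simp
    moreover have "0 < \<rho> * form \<rho> p q" using assms by (simp add: mult_neg_neg)
    ultimately show False by simp
  qed
  ultimately show ?thesis
    using assms by (simp add: space_form_def)
qed

lemma spherical_form_abs_le:
  assumes "0 < \<rho>" "p \<in> space_form \<rho>" "q \<in> space_form \<rho>"
  shows "\<bar>\<rho> * form \<rho> p q\<bar> \<le> 1"
proof -
  have f: "form \<rho> x y = x \<bullet> y" for x y
    using assms(1) by (simp add: form_def inner_vec_def sum_4)
  have "norm p = sqrt (1 / \<rho>)" "norm q = sqrt (1 / \<rho>)"
    using assms by (auto simp: space_form_def f norm_eq_sqrt_inner)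
  then have "\<bar>form \<rho> p q\<bar> \<le> 1 / \<rho>"
    using Cauchy_Schwarz_ineq2[of p q] assms(1) unfolding f by simp
  then show ?thesis
    using assms(1) by (simp add: abs_mult field_simps)
qed

lemma form_diff_square: "form \<rho> (p - q) (p - q) = form \<rho> p p + form \<rho> q q - 2 * form \<rho> p q"
  by (simp add: form_commute[of \<rho> q p])

text \<open>In each model the distance is an injective function of the square of the ambient chord.
  This reduces statements about isometries to statements about \<open>form\<close>.\<close>

lemma geo_dist_eq_iff:
  assumes "p \<in> space_form \<rho>" "q \<in> space_form \<rho>" "p' \<in> space_form \<rho>" "q' \<in> space_form \<rho>"
  shows "geo_dist \<rho> p' q' = geo_dist \<rho> p q \<longleftrightarrow>
    form \<rho> (p' - q') (p' - q') = form \<rho> (p - q) (p - q)"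
proof (cases "\<rho> = 0")
  case True
  then have f: "form \<rho> x x = (norm x)\<^sup>2" for x
    by (simp add: form_def power2_norm_eq_inner inner_vec_def sum_4)
  show ?thesis
    unfolding f using True by (simp add: geo_dist_def dist_norm)
next
  case False
  then have n: "form \<rho> x x = 1 / \<rho>" if "x \<in> space_form \<rho>" for x
    using that by (simp add: space_form_def split: if_splits)
  have "geo_dist \<rho> p' q' = geo_dist \<rho> p q \<longleftrightarrow> \<rho> * form \<rho> p' q' = \<rho> * form \<rho> p q"
  proof (cases "\<rho> > 0")
    case True
    then show ?thesis
      using arccos_eq_iff[of "\<rho> * form \<rho> p' q'" "\<rho> * form \<rho> p q"] spherical_form_abs_le[OF True] assms
      by (simp add: geo_dist_def)
  next
    case neg: False
    then have "cosh (arcosh (\<rho> * form \<rho> x y)) = \<rho> * form \<rho> x y"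
      if "x \<in> space_form \<rho>" "y \<in> space_form \<rho>" for x y
      using hyperbolic_form_ge that False by (intro cosh_arcosh_real) simp
    from this[OF assms(1,2)] this[OF assms(3,4)] show ?thesis
      using neg False by (auto simp: geo_dist_def)
  qed
  then show ?thesis
    unfolding form_diff_square using False by (simp add: n assms)
qed


section \<open>Planar curves\<close>

lemma conormal_linear_multiple: "\<rho> *\<^sub>R p = (form_sign \<rho> * sqrt \<bar>\<rho>\<bar>) *\<^sub>R conormal \<rho> p"
  by (simp add: conormal_def)

text \<open>The device for differentiating an identity that is known only on an open set: both sides
  have known derivatives, which must coincide. The Frenet equations and the components of
  \<open>X\<close> are all obtained this way.\<close>

lemma derivatives_agree:
  fixes f g :: "real \<Rightarrow> real"
  assumes "open J" "s \<in> J" "\<And>r. r \<in> J \<Longrightarrow> f r = g r"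
    and "(f has_real_derivative a) (at s)" "(g has_real_derivative b) (at s)"
  shows "a = b"
proof -
  have "(g has_real_derivative a) (at s)"
    using has_field_derivative_transform_within_open[OF assms(4,1,2,3)] by simp
  then show ?thesis using assms(5) DERIV_unique by blast
qed

locale planar_curve =
  fixes \<rho> :: real and J :: "real set" and \<gamma> :: "real \<Rightarrow> real^4"
  assumes arclength: "arclength_curve \<rho> J \<gamma>"
    and planar: "planar \<rho> J \<gamma>"
    and curvature_pos: "\<And>s. s \<in> J \<Longrightarrow> 0 < curvature \<rho> \<gamma> s"
begin

abbreviation "\<kappa> \<equiv> curvature \<rho> \<gamma>"
abbreviation "T \<equiv> velocity \<gamma>"
abbreviation "N \<equiv> frenet_normal \<rho> \<gamma>"
abbreviation "B \<equiv> binormal \<rho> \<gamma>"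

lemma open_J: "open J" and interval_J: "is_interval J"
  and smooth_\<gamma>: "smooth_on J \<gamma>"
  and \<gamma>_in: "s \<in> J \<Longrightarrow> \<gamma> s \<in> space_form \<rho>"
  and T_unit: "s \<in> J \<Longrightarrow> form \<rho> (T s) (T s) = 1"
  using arclength by (auto simp: arclength_curve_def)

lemma smooth_T: "smooth_on J T"
  by (rule smooth_on_vector_derivative[OF smooth_\<gamma> open_J])

lemma \<gamma>_derivative: "s \<in> J \<Longrightarrow> (\<gamma> has_vector_derivative T s) (at s)"
  by (rule smooth_on_has_vector_derivative[OF smooth_\<gamma>])

lemma conormal_derivative:
  assumes "s \<in> J"
  shows "((\<lambda>s. conormal \<rho> (\<gamma> s)) has_vector_derivative sqrt \<bar>\<rho>\<bar> *\<^sub>R T s) (at s)"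
  unfolding conormal_def using assms
  by (cases "\<rho> = 0") (auto intro!: derivative_eq_intros \<gamma>_derivative)

lemma tangent_field_derivative:
  assumes "s \<in> J" "\<And>r. r \<in> J \<Longrightarrow> form \<rho> (V r) (conormal \<rho> (\<gamma> r)) = 0"
    and "(V has_vector_derivative V') (at s)"
  shows "form \<rho> V' (conormal \<rho> (\<gamma> s)) = - sqrt \<bar>\<rho>\<bar> * form \<rho> (V s) (T s)"
  using derivatives_agree[OF open_J assms(1,2) form_has_derivative[OF assms(3)
        conormal_derivative[OF assms(1)]] DERIV_const]
  by simp

lemma T_tangent:
  assumes "s \<in> J"
  shows "form \<rho> (T s) (conormal \<rho> (\<gamma> s)) = 0"
proof (cases "\<rho> = 0")
  case True
  have "form \<rho> (axis 4 1) (\<gamma> r) = 1" if "r \<in> J" for r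
    using \<gamma>_in[OF that] True
    by (subst form_commute) (simp add: space_form_flat form_axis)
  from derivatives_agree[OF open_J assms this form_const_has_derivative[OF \<gamma>_derivative[OF assms]]
      DERIV_const]
  show ?thesis using True by (simp add: conormal_def form_commute)
next
  case False
  have "form \<rho> (\<gamma> r) (\<gamma> r) = 1 / \<rho>" if "r \<in> J" for r
    using space_form_norm[OF \<gamma>_in[OF that] False] False by (simp add: field_simps)
  from derivatives_agree[OF open_J assms this form_has_derivative[OF \<gamma>_derivative[OF assms]
        \<gamma>_derivative[OF assms]] DERIV_const]
  show ?thesis using False by (simp add: conormal_def form_commute)
qed

text \<open>The covariant acceleration with its correction term evaluated at unit speed, which makes
  smoothness on \<open>J\<close> evident.\<close>

definition accel :: "real \<Rightarrow> real^4" where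
  "accel s = vector_derivative T (at s) + \<rho> *\<^sub>R \<gamma> s"

lemma smooth_accel: "smooth_on J accel"
  unfolding accel_def
  by (intro smooth_on_add smooth_on_scaleR smooth_on_const smooth_\<gamma>
      smooth_on_vector_derivative[OF smooth_T open_J])

lemma covariant_T: "s \<in> J \<Longrightarrow> covariant_along \<rho> \<gamma> T s = accel s"
  by (simp add: covariant_along_def covariant_def accel_def T_unit)

lemma T_derivative': "s \<in> J \<Longrightarrow> (T has_vector_derivative accel s - \<rho> *\<^sub>R \<gamma> s) (at s)"
  using smooth_on_has_vector_derivative[OF smooth_T] by (simp add: accel_def)

text \<open>The position vector enters the structure equations only with the factor
  \<open>\<rho>\<close>; keeping this factor lets the flat case pass without separate
  treatment.\<close>

lemma \<rho>_\<gamma>: "form \<rho> v (conormal \<rho> (\<gamma> s)) = 0 \<Longrightarrow> \<rho> * form \<rho> v (\<gamma> s) = 0"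
  by (auto simp: conormal_def split: if_splits)

lemma accel_tangent:
  assumes "s \<in> J"
  shows "form \<rho> (accel s) (conormal \<rho> (\<gamma> s)) = 0"
proof -
  have "form \<rho> (\<rho> *\<^sub>R \<gamma> s) (conormal \<rho> (\<gamma> s)) = form_sign \<rho> * sqrt \<bar>\<rho>\<bar> * form_sign \<rho>"
    by (subst conormal_linear_multiple) (simp only: form_linear conormal_square[OF \<gamma>_in[OF assms]])
  then show ?thesis
    using tangent_field_derivative[OF assms T_tangent T_derivative'[OF assms]]
    by (simp add: T_unit assms split: if_splits)
qed

lemma T_accel:
  assumes "s \<in> J"
  shows "form \<rho> (T s) (accel s) = 0"
proof -
  have "form \<rho> (T s) (accel s - \<rho> *\<^sub>R \<gamma> s) + form \<rho> (accel s - \<rho> *\<^sub>R \<gamma> s) (T s) = 0"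
    using derivatives_agree[OF open_J assms T_unit
        form_has_derivative[OF T_derivative'[OF assms] T_derivative'[OF assms]] DERIV_const] .
  then show ?thesis
    using \<rho>_\<gamma>[OF T_tangent[OF assms]] by (simp add: form_commute[of \<rho> _ "T s"])
qed

text \<open>The root is written as a real power so that smoothness of powers on the positive half
  line applies.\<close>

lemma curvature_eq: "s \<in> J \<Longrightarrow> \<kappa> s = form \<rho> (accel s) (accel s) powr (1/2)"
  and accel_square: "s \<in> J \<Longrightarrow> form \<rho> (accel s) (accel s) = (\<kappa> s)\<^sup>2"
  using curvature_pos[of s] by (auto simp: curvature_def covariant_T powr_half_sqrt)

lemma smooth_\<kappa>: "smooth_on J \<kappa>"
proof (rule smooth_on_cong[OF open_J])
  show "smooth_on J (\<lambda>s. form \<rho> (accel s) (accel s) powr (1/2))"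
    by (intro smooth_on_powr smooth_on_form smooth_accel)
       (use curvature_pos accel_square in fastforce)
qed (simp add: curvature_eq)

lemma smooth_\<kappa>_powr: "smooth_on J (\<lambda>s. \<kappa> s powr a)"
  by (intro smooth_on_powr smooth_\<kappa> curvature_pos)

lemma accel_N: "s \<in> J \<Longrightarrow> accel s = \<kappa> s *\<^sub>R N s" and N_accel: "s \<in> J \<Longrightarrow> N s = (1 / \<kappa> s) *\<^sub>R accel s"
  using curvature_pos[of s] by (auto simp: frenet_normal_def covariant_T)

lemma smooth_N: "smooth_on J N"
proof (rule smooth_on_cong[OF open_J])
  show "smooth_on J (\<lambda>s. \<kappa> s powr (- 1) *\<^sub>R accel s)"
    by (intro smooth_on_scaleR smooth_\<kappa>_powr smooth_accel)
  show "\<kappa> s powr (- 1) *\<^sub>R accel s = N s" if "s \<in> J" for s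
    using curvature_pos[OF that] by (simp add: N_accel that powr_minus inverse_eq_divide)
qed

lemma T_derivative: "s \<in> J \<Longrightarrow> (T has_vector_derivative \<kappa> s *\<^sub>R N s - \<rho> *\<^sub>R \<gamma> s) (at s)"
  using T_derivative' accel_N by simp

lemma T_N: "s \<in> J \<Longrightarrow> form \<rho> (T s) (N s) = 0"
  and N_unit: "s \<in> J \<Longrightarrow> form \<rho> (N s) (N s) = 1"
  and N_tangent: "s \<in> J \<Longrightarrow> form \<rho> (N s) (conormal \<rho> (\<gamma> s)) = 0"
  using curvature_pos[of s]
  by (simp_all add: N_accel T_accel accel_square accel_tangent power2_eq_square)

lemma B_T: "form \<rho> (B s) (T s) = 0" and B_N: "form \<rho> (B s) (N s) = 0"
  and B_tangent: "form \<rho> (B s) (conormal \<rho> (\<gamma> s)) = 0"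
  by (simp_all add: binormal_def form_cross vol_degenerate)

lemma N_T: "s \<in> J \<Longrightarrow> form \<rho> (N s) (T s) = 0"
  using T_N by (simp add: form_commute)

lemma T_B: "form \<rho> (T s) (B s) = 0" and N_B: "form \<rho> (N s) (B s) = 0"
  using B_T B_N by (simp_all add: form_commute)

lemma B_unit: "s \<in> J \<Longrightarrow> form \<rho> (B s) (B s) = 1"
  by (simp add: binormal_def form_cross_self T_unit N_unit T_N T_tangent N_tangent
      conormal_square[OF \<gamma>_in])

lemma smooth_B: "smooth_on J B"
  unfolding binormal_def by (intro smooth_on_cross smooth_\<gamma> smooth_T smooth_N)

lemma orthogonal_to_frenet:
  assumes "s \<in> J" "form \<rho> v (T s) = 0" "form \<rho> v (N s) = 0" "form \<rho> v (B s) = 0"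
    "form \<rho> v (conormal \<rho> (\<gamma> s)) = 0"
  shows "v = 0"
  by (rule orthogonal_to_frame[where \<rho> = \<rho> and a = "T s" and b = "N s" and c = "B s"
        and d = "conormal \<rho> (\<gamma> s)"])
     (use assms in \<open>simp_all add: T_N T_tangent N_tangent B_tangent T_unit N_unit B_unit
       conormal_square[OF \<gamma>_in] T_B N_B\<close>)

text \<open>The frame components of \<open>N'\<close> come from differentiating orthogonality to
  \<open>T\<close>, unit length and tangency; the remaining one, along \<open>B\<close>, is the
  torsion.\<close>

lemma N_derivative:
  assumes s: "s \<in> J"
  shows "(N has_vector_derivative - \<kappa> s *\<^sub>R T s) (at s)"
proof -
  define N' where "N' = vector_derivative N (at s)"
  have d: "(N has_vector_derivative N') (at s)"
    unfolding N'_def by (rule smooth_on_has_vector_derivative[OF smooth_N s])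
  have "form \<rho> (T s) N' + form \<rho> (\<kappa> s *\<^sub>R N s - \<rho> *\<^sub>R \<gamma> s) (N s) = 0"
    by (rule derivatives_agree[OF open_J s T_N form_has_derivative[OF T_derivative[OF s] d] DERIV_const])
  then have 1: "form \<rho> N' (T s) = - \<kappa> s"
    using \<rho>_\<gamma>[OF N_tangent[OF s]] by (auto simp: N_unit s form_commute)
  have "form \<rho> (N s) N' + form \<rho> N' (N s) = 0"
    by (rule derivatives_agree[OF open_J s N_unit form_has_derivative[OF d d] DERIV_const])
  then have 2: "form \<rho> N' (N s) = 0"
    by (simp add: form_commute)
  have 3: "form \<rho> N' (conormal \<rho> (\<gamma> s)) = 0"
    using tangent_field_derivative[OF s N_tangent d] by (simp add: N_T s)
  have "torsion \<rho> \<gamma> s = 0"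
    using planar s by (simp add: planar_def)
  moreover have "covariant_along \<rho> \<gamma> N s = N'"
    by (simp add: covariant_along_def covariant_def T_N s N'_def)
  ultimately have 4: "form \<rho> N' (B s) = 0"
    by (simp add: torsion_def)
  have "N' + \<kappa> s *\<^sub>R T s = 0"
    by (rule orthogonal_to_frenet[OF s])
       (simp_all add: 1 2 3 4 T_unit T_N T_tangent T_B s)
  then show ?thesis using d by (simp add: add_eq_0_iff)
qed

lemma B_derivative:
  assumes s: "s \<in> J"
  shows "(B has_vector_derivative 0) (at s)"
proof -
  define B' where "B' = vector_derivative B (at s)"
  have d: "(B has_vector_derivative B') (at s)"
    unfolding B'_def by (rule smooth_on_has_vector_derivative[OF smooth_B s])
  have "form \<rho> (B s) (\<kappa> s *\<^sub>R N s - \<rho> *\<^sub>R \<gamma> s) + form \<rho> B' (T s) = 0"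
    by (rule derivatives_agree[OF open_J s B_T form_has_derivative[OF d T_derivative[OF s]] DERIV_const])
  then have 1: "form \<rho> B' (T s) = 0"
    using \<rho>_\<gamma>[OF B_tangent] by (simp add: B_N)
  have "form \<rho> (B s) (- \<kappa> s *\<^sub>R T s) + form \<rho> B' (N s) = 0"
    by (rule derivatives_agree[OF open_J s B_N form_has_derivative[OF d N_derivative[OF s]] DERIV_const])
  then have 2: "form \<rho> B' (N s) = 0" by (simp add: B_T)
  have "form \<rho> (B s) B' + form \<rho> B' (B s) = 0"
    by (rule derivatives_agree[OF open_J s B_unit form_has_derivative[OF d d] DERIV_const])
  then have 3: "form \<rho> B' (B s) = 0" by (simp add: form_commute)
  have 4: "form \<rho> B' (conormal \<rho> (\<gamma> s)) = 0"
    using tangent_field_derivative[OF s B_tangent d] by (simp add: B_T)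
  have "B' = 0" by (rule orthogonal_to_frenet[OF s 1 2 3 4])
  then show ?thesis using d by simp
qed

text \<open>The curve therefore lies in an ambient hyperplane orthogonal to this vector, which cuts
  the space form in a totally geodesic surface.\<close>

lemma B_constant: "s \<in> J \<Longrightarrow> r \<in> J \<Longrightarrow> B s = B r"
  by (rule vanishing_derivative_constant[OF interval_J B_derivative])

end

section \<open>Killing fields\<close>

text \<open>The Killing equation with both arguments equal to \<open>c'\<close> makes the derivative
  of the product vanish; the terms along the position vector disappear because both fields are
  tangent. The extension \<open>Y\<close> supplies the derivatives that \<open>X\<close> alone does
  not have.\<close>

lemma killing_field_geodesic:
  assumes kf: "killing_field \<rho> X"
    and in_M: "\<And>t. c t \<in> space_form \<rho>" and tan: "\<And>t. c' t \<in> tangent \<rho> (c t)"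
    and c: "\<And>t. (c has_vector_derivative c' t) (at t)"
    and c': "\<And>t. (c' has_vector_derivative - \<rho> *\<^sub>R c t) (at t)"
  shows "form \<rho> (X (c t)) (c' t) = form \<rho> (X (c 0)) (c' 0)"
proof -
  from kf obtain U Y where U: "open U" "space_form \<rho> \<subseteq> U" "smooth_on U Y"
    and YX: "\<And>p. p \<in> space_form \<rho> \<Longrightarrow> Y p = X p"
    and K: "\<And>p u v. p \<in> space_form \<rho> \<Longrightarrow> u \<in> tangent \<rho> p \<Longrightarrow> v \<in> tangent \<rho> p \<Longrightarrow>
       form \<rho> (covariant \<rho> p u (Y p) (frechet_derivative Y (at p) u)) v
         + form \<rho> u (covariant \<rho> p v (Y p) (frechet_derivative Y (at p) v)) = 0"
    unfolding killing_field_def by blast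
  have X_tan: "X p \<in> tangent \<rho> p" if "p \<in> space_form \<rho>" for p
    using kf that by (simp add: killing_field_def)
  have zero: "\<rho> * form \<rho> v p = 0" if "v \<in> tangent \<rho> p" for v p
    using that by (auto simp: tangent_def split: if_splits)
  have "((\<lambda>t. form \<rho> (Y (c t)) (c' t)) has_real_derivative 0) (at t)" for t
  proof -
    let ?D = "frechet_derivative Y (at (c t)) (c' t)"
    have "(Y has_derivative frechet_derivative Y (at (c t))) (at (c t))"
      using smooth_on_has_derivative[OF U(3)] U(2) in_M by blast
    then have "((\<lambda>t. Y (c t)) has_vector_derivative ?D) (at t)"
      using vector_derivative_diff_chain_within[of c "c' t" t UNIV Y "frechet_derivative Y (at (c t))"]
        c by (simp add: o_def has_derivative_at_withinI)
    then have d: "((\<lambda>t. form \<rho> (Y (c t)) (c' t)) has_real_derivative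
        form \<rho> (Y (c t)) (- \<rho> *\<^sub>R c t) + form \<rho> ?D (c' t)) (at t)"
      using c' by (rule form_has_derivative)
    have "form \<rho> ?D (c' t) = 0"
      using K[OF in_M tan tan, of t] zero[OF tan, of t]
      by (auto simp: covariant_def form_commute)
    then show ?thesis
      using d zero[OF X_tan[OF in_M], of t] by (simp add: YX in_M)
  qed
  then have "form \<rho> (Y (c t)) (c' t) = form \<rho> (Y (c 0)) (c' 0)"
    using DERIV_isconst_all[of "\<lambda>t. form \<rho> (Y (c t)) (c' t)" t 0] by blast
  then show ?thesis by (simp add: YX in_M)
qed

text \<open>In all three models geodesics solve c'' = - \<rho> c in the ambient space; for
  \<open>\<rho> = 0\<close> the coefficient of \<open>p\<close> stays 1 and the formula is a
  straight line.\<close>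

lemma geodesic_formula:
  assumes p: "p \<in> space_form \<rho>" and v: "v \<in> tangent \<rho> p" "form \<rho> v v = 1"
  defines "c \<equiv> \<lambda>t. (1 - \<rho> * gver \<rho> t) *\<^sub>R p + gsin \<rho> t *\<^sub>R v"
    and "c' \<equiv> \<lambda>t. (- \<rho> * gsin \<rho> t) *\<^sub>R p + (1 - \<rho> * gver \<rho> t) *\<^sub>R v"
  shows "c t \<in> space_form \<rho>" "c' t \<in> tangent \<rho> (c t)" "form \<rho> (c' t) (c' t) = 1"
    "(c has_vector_derivative c' t) (at t)" "(c' has_vector_derivative - \<rho> *\<^sub>R c t) (at t)"
proof -
  let ?C = "1 - \<rho> * gver \<rho> t" and ?S = "gsin \<rho> t"
  note cs = gcos_gsin_squared[of \<rho> t]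
  note [derivative_intros] = gsin_derivative gver_derivative
  show "(c has_vector_derivative c' t) (at t)" "(c' has_vector_derivative - \<rho> *\<^sub>R c t) (at t)"
    unfolding c_def c'_def by (auto intro!: derivative_eq_intros simp: algebra_simps)
  have "c t \<in> space_form \<rho> \<and> c' t \<in> tangent \<rho> (c t) \<and> form \<rho> (c' t) (c' t) = 1"
  proof (cases "\<rho> = 0")
    case True
    then show ?thesis using p v by (auto simp: c_def c'_def space_form_flat tangent_def)
  next
    case False
    have pp: "form \<rho> p p = 1 / \<rho>" and pv: "form \<rho> p v = 0" "form \<rho> v p = 0"
      using p v False by (auto simp: space_form_def tangent_def form_commute split: if_splits)
    have "form \<rho> (c t) (c t) = (?C\<^sup>2 + \<rho> * ?S\<^sup>2) / \<rho>"
      using False by (simp add: c_def pp pv v power2_eq_square add_divide_distrib)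
    then have cc: "form \<rho> (c t) (c t) = 1 / \<rho>" by (simp add: cs)
    have "form \<rho> (c' t) (c' t) = ?C\<^sup>2 + \<rho> * ?S\<^sup>2"
      using False by (simp add: c'_def pp pv v power2_eq_square)
    then have "form \<rho> (c' t) (c' t) = 1" by (simp add: cs)
    moreover have "form \<rho> (c' t) (c t) = 0"
      using False by (simp add: c_def c'_def pp pv v)
    moreover have "c t \<in> space_form \<rho>"
    proof (cases "\<rho> < 0")
      case neg: True
      \<comment> \<open>Nonnegativity of the versine keeps the product with \<open>p\<close>
        negative, so the geodesic cannot leave the sheet of \<open>p\<close>.\<close>
      have "0 \<le> gver \<rho> t"
        by (simp add: gsin_gver_half(2)[of \<rho> t])
      then have "0 < ?C"
        using neg by (smt (verit) mult_nonpos_nonneg)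
      then have "form \<rho> (c t) p < 0"
        using neg by (simp add: c_def pp pv divide_pos_neg)
      then show ?thesis using hyperbolic_same_sheet[OF neg p cc] by simp
    qed (use False cc in \<open>simp add: space_form_def\<close>)
    ultimately show ?thesis using False by (simp add: tangent_def)
  qed
  then show "c t \<in> space_form \<rho>" "c' t \<in> tangent \<rho> (c t)" "form \<rho> (c' t) (c' t) = 1" by auto
qed


text \<open>
  The infinitesimal form of the invariance of distances: the component of a Killing field along a
  geodesic is constant. It makes Killing fields affine, without any use of second derivatives.
\<close>

lemma killing_field_chord:
  assumes kf: "killing_field \<rho> X" and p: "p \<in> space_form \<rho>" and q: "q \<in> space_form \<rho>"
  shows "form \<rho> (X p - X q) (p - q) = 0"
proof -
  have X_tan: "X x \<in> tangent \<rho> x" if "x \<in> space_form \<rho>" for x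
    using kf that by (simp add: killing_field_def)
  \<comment> \<open>The generalised cosine of the distance from \<open>p\<close> to
    \<open>q\<close>; \<open>w\<close> is what remains of \<open>q\<close> in the tangent space at
    \<open>p\<close>.\<close>
  define C0 where "C0 = (if \<rho> = 0 then 1 else \<rho> * form \<rho> p q)"
  define w where "w = q - C0 *\<^sub>R p"
  have n: "form \<rho> x x = 1 / \<rho>" if "x \<in> space_form \<rho>" "\<rho> \<noteq> 0" for x
    using that by (simp add: space_form_def split: if_splits)
  have w_tan: "w \<in> tangent \<rho> p"
    using p q n[OF p] by (auto simp: tangent_def w_def C0_def space_form_flat form_commute[of \<rho> q])
  have Xp: "form \<rho> (X p) p = 0" and Xq: "form \<rho> (X q) q = 0" if "\<rho> \<noteq> 0"
    using X_tan[OF p] X_tan[OF q] that by (auto simp: tangent_def)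
  show ?thesis
  \<comment> \<open>For \<open>w = 0\<close> there is no direction from \<open>p\<close> to
    \<open>q\<close>: the points coincide or are antipodal on the sphere, and tangency alone gives
    the claim.\<close>
  proof (cases "w = 0")
    case True
    then have q_eq: "q = C0 *\<^sub>R p" by (simp add: w_def)
    show ?thesis
    proof (cases "\<rho> = 0")
      case True
      then show ?thesis using q_eq by (simp add: C0_def)
    next
      case False
      then have "C0 * C0 = 1"
        using n[OF p] n[OF q] q_eq by simp
      then have "C0 \<noteq> 0" by auto
      then have "form \<rho> (X q) p = 0" "form \<rho> (X p) q = 0"
        using Xp Xq False q_eq by auto
      then show ?thesis using Xp Xq False by simp
    qed
  next
    case False
    define S0 where "S0 = sqrt (form \<rho> w w)"
    define v where "v = (1 / S0) *\<^sub>R w"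
    have pos: "0 < form \<rho> w w" by (rule tangent_positive[OF p w_tan False])
    then have S0: "S0 > 0" "S0\<^sup>2 = form \<rho> w w" by (auto simp: S0_def)
    have v: "v \<in> tangent \<rho> p" "form \<rho> v v = 1"
      using w_tan S0 by (auto simp: v_def tangent_def power2_eq_square)
    have q_eq: "q = C0 *\<^sub>R p + S0 *\<^sub>R v"
      using S0 by (simp add: v_def w_def)
    have "C0\<^sup>2 + \<rho> * S0\<^sup>2 = 1"
    proof (cases "\<rho> = 0")
      case False
      then show ?thesis
        unfolding S0(2) w_def
        by (simp add: n p q C0_def form_commute[of \<rho> q p] power2_eq_square field_simps)
    qed (simp add: C0_def)
    moreover have "0 < C0" if "\<rho> \<le> 0"
      using that hyperbolic_form_ge[OF _ p q] by (auto simp: C0_def)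
    ultimately obtain t where t: "gsin \<rho> t = S0" "1 - \<rho> * gver \<rho> t = C0"
      using gsin_gver_attain by blast
    note g = geodesic_formula[OF p v]
    from killing_field_geodesic[OF kf g(1,2,4,5), of t]
    have c: "form \<rho> (X q) ((- \<rho> * S0) *\<^sub>R p + C0 *\<^sub>R v) = form \<rho> (X p) v"
      by (simp add: t q_eq)
    show ?thesis
    proof (cases "\<rho> = 0")
      case True
      then have "q - p = S0 *\<^sub>R v" by (simp add: q_eq C0_def)
      moreover from True c have "form \<rho> (X q) v = form \<rho> (X p) v" by (simp add: C0_def)
      ultimately have "form \<rho> (X q - X p) (q - p) = 0" by simp
      then show ?thesis by simp
    next
      case False
      have a: "form \<rho> (X p) q = S0 * form \<rho> (X p) v"
        using Xp[OF False] by (simp add: q_eq)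
      have b: "S0 * form \<rho> (X q) v = - C0 * form \<rho> (X q) p"
        using Xq[OF False] by (subst (asm) (2) q_eq) simp
      \<comment> \<open>Constancy of the component along the geodesic moves the product from
        \<open>p\<close> to \<open>q\<close>; tangency of \<open>X q\<close> and the conic relation
        between \<open>C0\<close> and \<open>S0\<close> then collapse it.\<close>
      have "form \<rho> (X p) q = - \<rho> * S0\<^sup>2 * form \<rho> (X q) p + C0 * (S0 * form \<rho> (X q) v)"
        unfolding a c[symmetric] by (simp add: power2_eq_square algebra_simps)
      also have "\<dots> = - (C0\<^sup>2 + \<rho> * S0\<^sup>2) * form \<rho> (X q) p"
        unfolding b by (simp add: power2_eq_square algebra_simps)
      finally have "form \<rho> (X p) q = - form \<rho> (X q) p"
        using \<open>C0\<^sup>2 + \<rho> * S0\<^sup>2 = 1\<close> by simp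
      then show ?thesis using Xp Xq False by simp
    qed
  qed
qed

section \<open>The flow on the extremal curve\<close>

locale extremal_curve = planar_curve +
  fixes X :: "real^4 \<Rightarrow> real^4" and \<phi> :: "real \<Rightarrow> real^4 \<Rightarrow> real^4" and s0 :: real
  assumes extremal: "extremal \<rho> J \<gamma>"
    and killing: "killing_field \<rho> X"
    and X_on_curve: "\<And>s. s \<in> J \<Longrightarrow> X (\<gamma> s) = (1 / (4 * \<kappa> s powr (3/4))) *\<^sub>R B s"
    and flow: "flow_of \<rho> X \<phi>"
    and s0: "s0 \<in> J"
begin

definition u :: "real \<Rightarrow> real" where "u = (\<lambda>s. 1 / \<kappa> s powr (3/4))"

lemma u_pos: "s \<in> J \<Longrightarrow> 0 < u s"
  using curvature_pos by (fastforce simp: u_def)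

lemma smooth_u: "smooth_on J u"
proof -
  have "u = (\<lambda>s. \<kappa> s powr (- (3/4)))"
    by (simp only: u_def powr_minus inverse_eq_divide)
  then show ?thesis using smooth_\<kappa>_powr by simp
qed

lemma smooth_u': "smooth_on J (deriv u)"
  by (rule smooth_on_deriv[OF smooth_u open_J])

lemmas u_derivative = smooth_on_real_derivative[OF smooth_u]

lemma u'_derivative:
  assumes "s \<in> J"
  shows "(deriv u has_real_derivative u s * (3 * (\<kappa> s)\<^sup>2 - \<rho>)) (at s)"
proof -
  have "\<kappa> s powr (3/4) * deriv (deriv u) s = 3 * (\<kappa> s)\<^sup>2 - \<rho>"
    using extremal assms by (auto simp: extremal_def u_def)
  then have "deriv (deriv u) s = u s * (3 * (\<kappa> s)\<^sup>2 - \<rho>)"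
    using curvature_pos[OF assms] by (simp add: u_def field_simps)
  then show ?thesis
    using smooth_on_real_derivative[OF smooth_u' assms] by simp
qed

text \<open>The exponents give 2 - 2 * 3/4 = 1/2, whence the root of the curvature. In this shape
  the first integral is the square of \<open>4 *\<^sub>R L\<close> computed in the frame.\<close>

lemma first_integral_eq:
  assumes "s \<in> J"
  shows "first_integral \<rho> \<gamma> s = (deriv u s)\<^sup>2 + \<rho> * (u s)\<^sup>2 + 9 * (\<kappa> s)\<^sup>2 * (u s)\<^sup>2"
proof -
  have k: "0 < \<kappa> s" by (rule curvature_pos[OF assms])
  have "(\<kappa> s)\<^sup>2 * (u s)\<^sup>2 = \<kappa> s powr 2 * (\<kappa> s powr (- (3/4))) powr 2"
    using k by (simp add: u_def powr_minus inverse_eq_divide)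
  also have "\<dots> = \<kappa> s powr (1/2)"
    by (simp add: powr_powr flip: powr_add)
  finally have "(\<kappa> s)\<^sup>2 * (u s)\<^sup>2 = sqrt (\<kappa> s)"
    using k by (simp add: powr_half_sqrt)
  then show ?thesis by (simp add: first_integral_def flip: u_def) (simp add: u_def)
qed

definition B0 :: "real^4" where "B0 = B s0"

text \<open>The value at \<open>s0\<close> of a vector that is constant along the curve. Its
  coefficients are those of \<open>- \<alpha> y\<close> in the components of \<open>X y\<close>
  given by \<open>\<rho>_X\<close>, \<open>X_T\<close> and \<open>X_N\<close>.\<close>

definition L :: "real^4" where
  "L = (\<rho> * u s0 / 4) *\<^sub>R \<gamma> s0 + (deriv u s0 / 4) *\<^sub>R T s0 + (3 * \<kappa> s0 * u s0 / 4) *\<^sub>R N s0"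

text \<open>The signed height over the hyperplane of the curve. The additive constants here and in
  \<open>\<beta>\<close> belong to the flat model, where the origin is not distinguished; for
  nonzero \<open>\<rho>\<close> they vanish.\<close>

definition \<alpha> :: "real^4 \<Rightarrow> real" where "\<alpha> p = form \<rho> B0 p - form \<rho> B0 (\<gamma> s0)"

definition \<beta> :: "real^4 \<Rightarrow> real" where "\<beta> p = form \<rho> L p + (u s0 / 4 - form \<rho> L (\<gamma> s0))"

lemma B_eq: "s \<in> J \<Longrightarrow> B s = B0"
  unfolding B0_def by (rule B_constant[OF _ s0])

lemma B0_unit: "form \<rho> B0 B0 = 1"
  by (simp add: B0_def B_unit s0)

lemma B0_T: "s \<in> J \<Longrightarrow> form \<rho> B0 (T s) = 0" and B0_N: "s \<in> J \<Longrightarrow> form \<rho> B0 (N s) = 0"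
  and B0_conormal: "s \<in> J \<Longrightarrow> form \<rho> B0 (conormal \<rho> (\<gamma> s)) = 0"
  using B_T B_N B_tangent B_eq by metis+

lemma \<alpha>_curve: "s \<in> J \<Longrightarrow> \<alpha> (\<gamma> s) = 0"
proof -
  assume s: "s \<in> J"
  have "((\<lambda>s. form \<rho> B0 (\<gamma> s)) has_vector_derivative 0) (at r)" if "r \<in> J" for r
    using form_const_has_derivative[OF \<gamma>_derivative[OF that], of \<rho> B0] B0_T[OF that]
    by (simp add: has_real_derivative_iff_has_vector_derivative)
  from vanishing_derivative_constant[OF interval_J this s s0] show ?thesis
    by (simp add: \<alpha>_def)
qed

section \<open>Components of the Killing field in the Frenet frame\<close>

lemma X_on_curve': "s \<in> J \<Longrightarrow> X (\<gamma> s) = (u s / 4) *\<^sub>R B0"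
  by (simp add: X_on_curve u_def B_eq)

lemma X_tangent: "y \<in> space_form \<rho> \<Longrightarrow> X y \<in> tangent \<rho> y"
  using killing by (simp add: killing_field_def)

text \<open>The chord identity with one end on the curve. As the curve has constant height, the
  right-hand side depends on \<open>s\<close> only through \<open>u\<close>, and can be
  differentiated in \<open>s\<close> with \<open>y\<close> fixed.\<close>

lemma X_chord_curve:
  assumes y: "y \<in> space_form \<rho>" and s: "s \<in> J"
  shows "form \<rho> (X y) (\<gamma> s) = form \<rho> (X y) y - u s / 4 * \<alpha> y"
proof -
  have "form \<rho> (X y - X (\<gamma> s)) (y - \<gamma> s) = 0"
    by (rule killing_field_chord[OF killing y \<gamma>_in[OF s]])
  moreover have "form \<rho> B0 (\<gamma> s) = form \<rho> B0 (\<gamma> s0)"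
    using \<alpha>_curve[OF s] by (simp add: \<alpha>_def)
  ultimately show ?thesis
    by (simp add: X_on_curve' s \<alpha>_def algebra_simps)
qed

lemma X_T:
  assumes y: "y \<in> space_form \<rho>" and s: "s \<in> J"
  shows "form \<rho> (X y) (T s) = - (deriv u s / 4 * \<alpha> y)"
proof -
  have "((\<lambda>s. form \<rho> (X y) y - u s / 4 * \<alpha> y) has_real_derivative - (deriv u s / 4 * \<alpha> y)) (at s)"
    by (auto intro!: derivative_eq_intros u_derivative s)
  from derivatives_agree[OF open_J s X_chord_curve[OF y]
      form_const_has_derivative[OF \<gamma>_derivative[OF s]] this]
  show ?thesis .
qed

lemma \<rho>_X:
  assumes y: "y \<in> space_form \<rho>" and s: "s \<in> J"
  shows "\<rho> * form \<rho> (X y) (\<gamma> s) = - (\<rho> * u s / 4 * \<alpha> y)"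
  using X_tangent[OF y] by (auto simp: X_chord_curve y s tangent_def split: if_splits)

text \<open>The second derivative of the chord identity. The term in the position vector cancels the
  \<rho>-term of the Euler-Lagrange equation, and one factor \<kappa> can be divided out.\<close>

lemma X_N:
  assumes y: "y \<in> space_form \<rho>" and s: "s \<in> J"
  shows "form \<rho> (X y) (N s) = - (3 * \<kappa> s * u s / 4 * \<alpha> y)"
proof -
  have "((\<lambda>s. - (deriv u s / 4 * \<alpha> y)) has_real_derivative
      - (u s * (3 * (\<kappa> s)\<^sup>2 - \<rho>) / 4 * \<alpha> y)) (at s)"
    by (auto intro!: derivative_eq_intros u'_derivative s)
  from derivatives_agree[OF open_J s X_T[OF y]
      form_const_has_derivative[OF T_derivative[OF s]] this]
  have "\<kappa> s * form \<rho> (X y) (N s) - \<rho> * form \<rho> (X y) (\<gamma> s) = - (u s * (3 * (\<kappa> s)\<^sup>2 - \<rho>) / 4 * \<alpha> y)"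
    by simp
  then have "\<kappa> s * form \<rho> (X y) (N s) = \<kappa> s * - (3 * \<kappa> s * u s / 4 * \<alpha> y)"
    unfolding \<rho>_X[OF y s] by (simp add: power2_eq_square algebra_simps) argo
  then show ?thesis
    using curvature_pos[OF s] by (metis mult_left_cancel less_irrefl)
qed

lemma L_T0: "form \<rho> L (T s0) = deriv u s0 / 4"
  and L_N0: "form \<rho> L (N s0) = 3 * \<kappa> s0 * u s0 / 4"
  and L_B0: "form \<rho> L B0 = 0"
  and \<rho>_L_\<gamma>0: "\<rho> * form \<rho> L (\<gamma> s0) = \<rho> * u s0 / 4"
proof -
  have z: "\<rho> * form \<rho> (\<gamma> s0) v = 0" if "form \<rho> v (conormal \<rho> (\<gamma> s0)) = 0" for v
    using \<rho>_\<gamma>[OF that] by (simp add: form_commute)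
  note z' = z[OF T_tangent[OF s0]] z[OF N_tangent[OF s0]] z[OF B0_conormal[OF s0]]
  note f = form_commute[of \<rho> "T s0"] form_commute[of \<rho> "N s0"]
  show "form \<rho> L (T s0) = deriv u s0 / 4"
    using z'(1) by (auto simp: L_def T_unit N_T s0)
  show "form \<rho> L (N s0) = 3 * \<kappa> s0 * u s0 / 4"
    using z'(2) by (auto simp: L_def N_unit T_N s0)
  show "form \<rho> L B0 = 0"
    using z'(3) T_B[of s0] N_B[of s0] by (auto simp: L_def B0_def)
  show "\<rho> * form \<rho> L (\<gamma> s0) = \<rho> * u s0 / 4"
    using z'(1,2) space_form_norm[OF \<gamma>_in[OF s0]]
    by (cases "\<rho> = 0") (simp_all add: L_def f)
qed

lemma L_conormal: "form \<rho> L (conormal \<rho> (\<gamma> s0)) = sqrt \<bar>\<rho>\<bar> * u s0 / 4"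
proof (cases "\<rho> = 0")
  case True
  have "form \<rho> L (conormal \<rho> (\<gamma> s0)) = \<rho> * u s0 / 4 * form \<rho> (\<gamma> s0) (conormal \<rho> (\<gamma> s0))"
    unfolding L_def by (simp add: T_tangent N_tangent s0)
  then show ?thesis using True by simp
next
  case False
  have "\<rho> * form \<rho> L (\<gamma> s0) = \<rho> * (u s0 / 4)" using \<rho>_L_\<gamma>0 by simp
  then have "form \<rho> L (\<gamma> s0) = u s0 / 4" using False mult_left_cancel by blast
  then show ?thesis using False by (simp add: conormal_def)
qed

lemma B0_L: "form \<rho> B0 L = 0"
  using L_B0 by (simp add: form_commute)

text \<open>At \<open>s0\<close> the components along \<open>T\<close>, \<open>N\<close> and the
  conormal are known multiples of \<open>\<alpha> y\<close>, and they are those of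
  \<open>- \<alpha> y *\<^sub>R L\<close>. The component along \<open>B0\<close> is left as it
  is.\<close>

lemma X_expand:
  assumes y: "y \<in> space_form \<rho>"
  shows "X y = form \<rho> (X y) B0 *\<^sub>R B0 - \<alpha> y *\<^sub>R L"
proof -
  define d where "d = X y + \<alpha> y *\<^sub>R L - form \<rho> (X y) B0 *\<^sub>R B0"
  have c: "form \<rho> (X y) (conormal \<rho> (\<gamma> s0)) = - (sqrt \<bar>\<rho>\<bar> * u s0 / 4 * \<alpha> y)"
  proof (cases "\<rho> = 0")
    case True
    then show ?thesis using X_tangent[OF y] by (simp add: tangent_def conormal_def form_axis)
  next
    case False
    have "\<rho> * form \<rho> (X y) (\<gamma> s0) = \<rho> * - (u s0 / 4 * \<alpha> y)" using \<rho>_X[OF y s0] by simp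
    then have "form \<rho> (X y) (\<gamma> s0) = - (u s0 / 4 * \<alpha> y)" using False mult_left_cancel by blast
    then show ?thesis using False by (simp add: conormal_def)
  qed
  have "d = 0"
  proof (rule orthogonal_to_frenet[OF s0])
    show "form \<rho> d (T s0) = 0" "form \<rho> d (N s0) = 0" "form \<rho> d (B s0) = 0"
      using X_T[OF y s0] X_N[OF y s0]
      by (simp_all add: d_def L_T0 L_N0 L_B0 B0_T B0_N B0_unit s0 B_eq)
    show "form \<rho> d (conormal \<rho> (\<gamma> s0)) = 0"
      by (simp add: d_def c L_conormal B0_conormal s0)
  qed
  then show ?thesis by (simp add: d_def algebra_simps)
qed

lemma \<alpha>_diff: "form \<rho> B0 (y - z) = \<alpha> y - \<alpha> z" and \<beta>_diff: "form \<rho> L (y - z) = \<beta> y - \<beta> z"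
  by (simp_all add: \<alpha>_def \<beta>_def)

lemma X_formula:
  assumes y: "y \<in> space_form \<rho>"
  shows "X y = \<beta> y *\<^sub>R B0 - \<alpha> y *\<^sub>R L"
proof -
  \<comment> \<open>Two points at different heights have the same difference between the open
    coefficient and \<open>\<beta>\<close>.\<close>
  have chord: "(k - l) * (\<alpha> y - \<alpha> z) = (\<alpha> y - \<alpha> z) * (\<beta> y - \<beta> z)"
    if "y \<in> space_form \<rho>" "z \<in> space_form \<rho>" "X y = k *\<^sub>R B0 - \<alpha> y *\<^sub>R L" "X z = l *\<^sub>R B0 - \<alpha> z *\<^sub>R L"
    for y z k l
  proof -
    have "X y - X z = (k - l) *\<^sub>R B0 - (\<alpha> y - \<alpha> z) *\<^sub>R L"
      unfolding that(3,4) by (simp add: algebra_simps)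
    then have "form \<rho> ((k - l) *\<^sub>R B0 - (\<alpha> y - \<alpha> z) *\<^sub>R L) (y - z) = 0"
      using killing_field_chord[OF killing that(1,2)] by simp
    then show ?thesis
      by (simp only: form_linear(3,7) \<alpha>_diff \<beta>_diff right_minus_eq)
  qed
  have X0: "X (\<gamma> s0) = (u s0 / 4) *\<^sub>R B0 - \<alpha> (\<gamma> s0) *\<^sub>R L"
    by (simp add: X_on_curve' s0 \<alpha>_curve)
  have \<beta>0: "\<beta> (\<gamma> s0) = u s0 / 4" by (simp add: \<beta>_def)
  \<comment> \<open>Off the hyperplane of the curve, comparison with \<open>\<gamma> s0\<close>
    settles the coefficient.\<close>
  have off: "form \<rho> (X z) B0 = \<beta> z" if "z \<in> space_form \<rho>" "\<alpha> z \<noteq> 0" for z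
    using chord[OF that(1) \<gamma>_in[OF s0] X_expand[OF that(1)] X0] that(2) s0
    by (simp add: \<alpha>_curve \<beta>0 mult.commute)
  have "form \<rho> (X y) B0 = \<beta> y"
  proof (cases "\<alpha> y = 0")
    case True
    \<comment> \<open>A point of the hyperplane has to be compared with one outside it: the geodesic
      from \<open>\<gamma> s0\<close> in the direction \<open>B0\<close> leaves the hyperplane
      wherever the generalised sine is nonzero.\<close>
    obtain t where t: "gsin \<rho> t \<noteq> 0"
    proof -
      have "\<exists>t. gsin \<rho> t \<noteq> 0"
      proof (rule ccontr)
        assume "\<not> ?thesis"
        then have "gsin \<rho> = (\<lambda>_. 0)" by auto
        then show False using gsin_derivative[of \<rho> 0] DERIV_unique[OF _ DERIV_const] by fastforce
      qed
      then show ?thesis using that by blast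
    qed
    define z where "z = (1 - \<rho> * gver \<rho> t) *\<^sub>R \<gamma> s0 + gsin \<rho> t *\<^sub>R B0"
    have z: "z \<in> space_form \<rho>"
      unfolding z_def by (rule geodesic_formula(1)[OF \<gamma>_in[OF s0] _ B0_unit])
        (simp add: tangent_iff_conormal B0_conormal s0)
    have "\<alpha> z = gsin \<rho> t"
      using \<rho>_\<gamma>[OF B0_conormal[OF s0]] by (auto simp: z_def \<alpha>_def B0_unit)
    then show ?thesis
      using chord[OF y z X_expand[OF y] X_expand[OF z]] off[OF z] True t
      by simp
  qed (rule off[OF y])
  then show ?thesis using X_expand[OF y] by simp
qed

lemma \<beta>_curve: "s \<in> J \<Longrightarrow> \<beta> (\<gamma> s) = u s / 4"
proof -
  assume s: "s \<in> J"
  have "(u s / 4) *\<^sub>R B0 = \<beta> (\<gamma> s) *\<^sub>R B0"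
    using X_formula[OF \<gamma>_in[OF s]] X_on_curve'[OF s] \<alpha>_curve[OF s] by simp
  moreover have "B0 \<noteq> 0" using B0_unit by auto
  ultimately show ?thesis by simp
qed

lemma L_\<gamma>: "s \<in> J \<Longrightarrow> form \<rho> L (\<gamma> s) = u s / 4 - (u s0 / 4 - form \<rho> L (\<gamma> s0))"
  by (drule \<beta>_curve) (simp add: \<beta>_def)

lemma \<rho>_L_\<gamma>: "s \<in> J \<Longrightarrow> \<rho> * form \<rho> L (\<gamma> s) = \<rho> * u s / 4"
  using \<rho>_L_\<gamma>0 by (simp add: L_\<gamma> algebra_simps)

text \<open>Comparing both formulas for \<open>X\<close> on the curve gave \<open>\<beta>\<close> at
  every \<open>s\<close>; differentiating it yields the components of the fixed vector
  \<open>L\<close> in the moving frame, without proving separately that the formula for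
  \<open>L\<close> is independent of \<open>s0\<close>.\<close>

lemma L_T: "s \<in> J \<Longrightarrow> form \<rho> L (T s) = deriv u s / 4"
proof -
  assume s: "s \<in> J"
  have "((\<lambda>s. u s / 4 - (u s0 / 4 - form \<rho> L (\<gamma> s0))) has_real_derivative deriv u s / 4) (at s)"
    by (auto intro!: derivative_eq_intros u_derivative s)
  from derivatives_agree[OF open_J s L_\<gamma> form_const_has_derivative[OF \<gamma>_derivative[OF s]] this]
  show ?thesis .
qed

lemma L_N: "s \<in> J \<Longrightarrow> form \<rho> L (N s) = 3 * \<kappa> s * u s / 4"
proof -
  assume s: "s \<in> J"
  have "((\<lambda>s. deriv u s / 4) has_real_derivative u s * (3 * (\<kappa> s)\<^sup>2 - \<rho>) / 4) (at s)"
    by (auto intro!: derivative_eq_intros u'_derivative s)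
  from derivatives_agree[OF open_J s L_T form_const_has_derivative[OF T_derivative[OF s]] this]
  have "\<kappa> s * form \<rho> L (N s) = \<kappa> s * (3 * \<kappa> s * u s / 4)"
    using \<rho>_L_\<gamma>[OF s] by (simp add: power2_eq_square algebra_simps)
  then show ?thesis using curvature_pos[OF s] by simp
qed

section \<open>The orbits of the points of the curve\<close>

definition m :: real where "m = form \<rho> L L"

lemma m_eq: "16 * m = first_integral \<rho> \<gamma> s0"
proof -
  have "form \<rho> L L = \<rho> * u s0 / 4 * form \<rho> L (\<gamma> s0) + deriv u s0 / 4 * form \<rho> L (T s0)
      + 3 * \<kappa> s0 * u s0 / 4 * form \<rho> L (N s0)"
    by (subst (2) L_def) simp
  also have "\<rho> * u s0 / 4 * form \<rho> L (\<gamma> s0) = u s0 / 4 * (\<rho> * form \<rho> L (\<gamma> s0))" by simp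
  finally show ?thesis
    unfolding m_def L_T0 L_N0 \<rho>_L_\<gamma>0 first_integral_eq[OF s0]
    by (simp add: power2_eq_square)
qed

text \<open>The shape common to all orbits of points of the curve: each is a translate of a multiple
  of \<open>W\<close>, and the field along it is the same multiple of the derivative
  \<open>V\<close>.\<close>

definition W :: "real \<Rightarrow> real^4" where "W t = gsin m t *\<^sub>R B0 - gver m t *\<^sub>R L"

definition V :: "real \<Rightarrow> real^4" where "V t = (1 - m * gver m t) *\<^sub>R B0 - gsin m t *\<^sub>R L"

lemma W_derivative: "(W has_vector_derivative V t) (at t)"
  unfolding W_def V_def
  by (auto intro!: derivative_eq_intros gsin_derivative gver_derivative)

lemma L_L: "form \<rho> L L = m"
  by (simp add: m_def)

text \<open>Since \<open>B0\<close> and \<open>L\<close> are orthogonal with squares 1 and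
  \<open>m\<close>, the values of \<open>\<alpha>\<close> and \<open>\<beta>\<close> along an orbit
  form a closed harmonic system. Once they are known, the field along the orbit is an explicit
  function of time and can be integrated.\<close>

lemma flow_curve:
  assumes s: "s \<in> J"
  shows "\<phi> t (\<gamma> s) = \<gamma> s + (u s / 4) *\<^sub>R W t"
proof -
  define y where "y t = \<phi> t (\<gamma> s)" for t
  have y_in: "y t \<in> space_form \<rho>" and y': "(y has_vector_derivative X (y t)) (at t)"
    and y0: "y 0 = \<gamma> s" for t
    using flow \<gamma>_in[OF s] unfolding flow_of_def y_def[abs_def] by auto
  have a: "((\<lambda>t. \<alpha> (y t)) has_real_derivative \<beta> (y t)) (at t)" for t
    unfolding \<alpha>_def
    by (auto intro!: derivative_eq_intros form_const_has_derivative[OF y']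
        simp: X_formula[OF y_in] B0_unit B0_L)
  have b: "((\<lambda>t. \<beta> (y t)) has_real_derivative - m * \<alpha> (y t)) (at t)" for t
    unfolding \<beta>_def
    by (auto intro!: derivative_eq_intros form_const_has_derivative[OF y']
        simp: X_formula[OF y_in] L_B0 L_L)
  have \<alpha>\<beta>: "\<alpha> (y t) = u s / 4 * gsin m t" "\<beta> (y t) = u s / 4 * (1 - m * gver m t)" for t
    using harmonic_unique[OF a b] y0 by (simp_all add: \<alpha>_curve \<beta>_curve s)
  have "X (y t) = (u s / 4) *\<^sub>R V t" for t
    unfolding X_formula[OF y_in] \<alpha>\<beta> V_def by (simp add: algebra_simps)
  then have "((\<lambda>t. y t - (u s / 4) *\<^sub>R W t) has_vector_derivative 0) (at t)" for t
    using y'[of t] by (auto intro!: derivative_eq_intros W_derivative)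
  then have "y t - (u s / 4) *\<^sub>R W t = y 0 - (u s / 4) *\<^sub>R W 0"
    using vanishing_derivative_constant[of UNIV "\<lambda>t. y t - (u s / 4) *\<^sub>R W t"] by simp
  then show ?thesis by (simp add: y0 W_def y_def[symmetric] algebra_simps)
qed

end


section \<open>The curvatures of the swept surface\<close>

context extremal_curve
begin

lemma conic: "(gsin m t)\<^sup>2 = 2 * gver m t - m * (gver m t)\<^sup>2"
  using gsin_gver_conic[of m t] by simp

lemma W_forms: "form \<rho> (W t) (W t) = 2 * gver m t" "form \<rho> (V t) (V t) = 1" "form \<rho> (W t) (V t) = gsin m t"
    "form \<rho> B0 (W t) = gsin m t" "form \<rho> L (W t) = - (m * gver m t)"
    "form \<rho> B0 (V t) = 1 - m * gver m t" "form \<rho> L (V t) = - (m * gsin m t)"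
  using conic[of t] gcos_gsin_squared[of m t]
  by (simp_all add: W_def V_def B0_unit B0_L L_B0 L_L power2_eq_square algebra_simps)

text \<open>Vectors orthogonal to \<open>B0\<close> are moved by the flow as \<open>v \<mapsto> v + form L v W\<close>.\<close>

definition push :: "real \<Rightarrow> real^4 \<Rightarrow> real^4" where "push t v = v + form \<rho> L v *\<^sub>R W t"

lemma W_orthogonal:
  assumes "form \<rho> B0 v = 0"
  shows "form \<rho> v (W t) = - (gver m t * form \<rho> L v)" "form \<rho> v (V t) = - (gsin m t * form \<rho> L v)"
  using assms by (simp_all add: W_def V_def form_commute[of \<rho> v])

text \<open>The square of \<open>W t\<close>, twice the versine, cancels against the two mixed
  terms, each of which contributes one versine with a minus sign.\<close>

lemma push_form:
  assumes "form \<rho> B0 v = 0" "form \<rho> B0 w = 0"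
  shows "form \<rho> (push t v) (push t w) = form \<rho> v w"
  using assms
  by (simp add: push_def W_forms W_orthogonal form_commute[of \<rho> "W t" w] algebra_simps)

lemma push_V: "form \<rho> B0 v = 0 \<Longrightarrow> form \<rho> (push t v) (V t) = 0"
  by (simp add: push_def W_forms W_orthogonal)

abbreviation "x \<equiv> sweep \<gamma> \<phi>"
abbreviation "U \<equiv> sweep_domain J"

text \<open>The pushed principal normal with reversed sign; this choice of side makes the first
  principal curvature \<open>- \<kappa>\<close> instead of \<open>\<kappa>\<close>.\<close>

definition \<eta> :: "real^2 \<Rightarrow> real^4" where
  "\<eta> q = - (N (q$1) + (3 * \<kappa> (q$1) * u (q$1) / 4) *\<^sub>R W (q$2))"

lemma \<eta>_push: "q \<in> U \<Longrightarrow> \<eta> q = - push (q$2) (N (q$1))"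
  by (simp add: \<eta>_def push_def L_N sweep_domain_def)

lemma x_eq: "q \<in> U \<Longrightarrow> x q = \<gamma> (q$1) + (u (q$1) / 4) *\<^sub>R W (q$2)"
  by (simp add: sweep_def sweep_domain_def flow_curve)

lemma x_in: "q \<in> U \<Longrightarrow> x q \<in> space_form \<rho>"
  using flow \<gamma>_in by (simp add: sweep_def sweep_domain_def flow_of_def)

lemma open_U: "open U"
proof -
  have "U = (\<lambda>q. q$1) -` J" by (auto simp: sweep_domain_def)
  then show ?thesis
    using open_J by (simp add: open_vimage continuous_on_component)
qed

lemma smooth_on_U: "smooth_on J f \<Longrightarrow> smooth_on U (\<lambda>q. f (q$1))"
  for f :: "real \<Rightarrow> 'b::euclidean_space"
  by (rule smooth_on_compose_real[where V = J])
     (auto simp: sweep_domain_def intro: smooth_on_bounded_linear bounded_linear_vec_nth)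

lemma smooth_on_U2: "smooth_on UNIV f \<Longrightarrow> smooth_on U (\<lambda>q. f (q$2))"
  for f :: "real \<Rightarrow> 'b::euclidean_space"
  by (rule smooth_on_compose_real[where V = UNIV])
     (auto intro: smooth_on_bounded_linear bounded_linear_vec_nth)

lemma smooth_W: "smooth_on UNIV W"
  unfolding W_def
  by (intro smooth_on_diff smooth_on_scaleR smooth_on_gsin smooth_on_gver smooth_on_const)

lemma smooth_x: "smooth_on U x"
proof (rule smooth_on_cong[OF open_U])
  show "smooth_on U (\<lambda>q. \<gamma> (q$1) + ((1 / 4) * u (q$1)) *\<^sub>R W (q$2))"
    by (intro smooth_on_add smooth_on_scaleR smooth_on_mult smooth_on_const
        smooth_on_U[OF smooth_\<gamma>] smooth_on_U[OF smooth_u] smooth_on_U2[OF smooth_W])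
qed (simp add: x_eq)

lemma smooth_\<eta>: "smooth_on U \<eta>"
proof -
  have "smooth_on U (\<lambda>q. - (N (q$1) + ((3 / 4) * \<kappa> (q$1) * u (q$1)) *\<^sub>R W (q$2)))"
    by (intro smooth_on_add smooth_on_scaleR smooth_on_mult smooth_on_minus smooth_on_const
        smooth_on_U[OF smooth_N] smooth_on_U[OF smooth_\<kappa>] smooth_on_U[OF smooth_u]
        smooth_on_U2[OF smooth_W])
  then show ?thesis by (simp add: \<eta>_def[abs_def])
qed

lemma chain_coordinate:
  fixes f :: "real \<Rightarrow> 'b::real_normed_vector" and q :: "real^2"
  assumes "(f has_vector_derivative f') (at (q$i))"
  shows "((\<lambda>q. f (q$i)) has_derivative (\<lambda>v. v$i *\<^sub>R f')) (at q)"
  by (rule has_derivative_compose[where f = "\<lambda>q. q$i" and g = f])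
     (use assms in \<open>auto simp: has_vector_derivative_def
       intro: bounded_linear_imp_has_derivative bounded_linear_vec_nth\<close>)

text \<open>Both the immersion and its normal have this shape, a curve plus a multiple of
  \<open>W\<close>.\<close>

lemma swept_has_derivative:
  fixes q :: "real^2"
  assumes "(f has_vector_derivative f') (at (q$1))" "(g has_real_derivative g') (at (q$1))"
  shows "((\<lambda>q. f (q$1) + g (q$1) *\<^sub>R W (q$2)) has_derivative
    (\<lambda>v. v$1 *\<^sub>R (f' + g' *\<^sub>R W (q$2)) + (v$2 * g (q$1)) *\<^sub>R V (q$2))) (at q)"
proof -
  have g: "((\<lambda>q. g (q$1)) has_derivative (\<lambda>v. v$1 *\<^sub>R g')) (at q)"
    by (rule chain_coordinate) (use assms(2) in \<open>simp add: has_real_derivative_iff_has_vector_derivative\<close>)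
  show ?thesis
    by (rule has_derivative_eq_rhs[OF has_derivative_add[OF chain_coordinate[OF assms(1)]
          has_derivative_scaleR[OF g chain_coordinate[OF W_derivative]]]])
       (simp add: fun_eq_iff algebra_simps)
qed

lemma x_differential:
  assumes q: "q \<in> U"
  shows "differential x q v = v$1 *\<^sub>R push (q$2) (T (q$1)) + (v$2 * (u (q$1) / 4)) *\<^sub>R V (q$2)"
proof -
  have s: "q$1 \<in> J" using q by (simp add: sweep_domain_def)
  have "((\<lambda>s. u s / 4) has_real_derivative deriv u (q$1) / 4) (at (q$1))"
    by (auto intro!: derivative_eq_intros u_derivative s)
  from swept_has_derivative[OF \<gamma>_derivative[OF s] this]
  have "((\<lambda>q. \<gamma> (q$1) + (u (q$1) / 4) *\<^sub>R W (q$2)) has_derivative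
      (\<lambda>v. v$1 *\<^sub>R push (q$2) (T (q$1)) + (v$2 * (u (q$1) / 4)) *\<^sub>R V (q$2))) (at q)"
    by (simp add: push_def L_T s)
  then have "(x has_derivative (\<lambda>v. v$1 *\<^sub>R push (q$2) (T (q$1)) + (v$2 * (u (q$1) / 4)) *\<^sub>R V (q$2))) (at q)"
    by (rule has_derivative_transform_within_open[OF _ open_U q]) (simp add: x_eq)
  then show ?thesis by (simp add: frechet_derivative_at[symmetric])
qed

text \<open>In the first direction this is the Frenet equation of \<open>N\<close>, pushed by the
  flow. In the second, \<open>V\<close> has the coefficient \<open>3 * \<kappa> * u / 4\<close> in
  the derivative of \<open>- \<eta>\<close> and \<open>u / 4\<close> in that of \<open>x\<close>;
  their quotient is the second principal curvature.\<close>

lemma \<eta>_differential: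
  assumes q: "q \<in> U"
  shows "differential \<eta> q v = - differential x q (vector [- \<kappa> (q$1) * v$1, 3 * \<kappa> (q$1) * v$2])"
proof -
  have s: "q$1 \<in> J" using q by (simp add: sweep_domain_def)
  define g where "g s = form \<rho> L (N s)" for s
  have g: "(g has_real_derivative - \<kappa> (q$1) * form \<rho> L (T (q$1))) (at (q$1))"
    using form_const_has_derivative[OF N_derivative[OF s], of \<rho> L] by (simp add: g_def[abs_def])
  let ?D = "\<lambda>v. v$1 *\<^sub>R (- \<kappa> (q$1) *\<^sub>R T (q$1) + (- \<kappa> (q$1) * form \<rho> L (T (q$1))) *\<^sub>R W (q$2))
     + (v$2 * g (q$1)) *\<^sub>R V (q$2)"
  have "((\<lambda>q. - (N (q$1) + g (q$1) *\<^sub>R W (q$2))) has_derivative (\<lambda>v. - ?D v)) (at q)"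
    by (rule has_derivative_minus[OF swept_has_derivative[OF N_derivative[OF s] g]])
  then have "(\<eta> has_derivative (\<lambda>v. - ?D v)) (at q)"
    by (rule has_derivative_transform_within_open[OF _ open_U q])
       (simp add: \<eta>_push push_def g_def)
  then have "differential \<eta> q v = - ?D v"
    by (simp add: frechet_derivative_at[symmetric])
  also have "?D v = differential x q (vector [- \<kappa> (q$1) * v$1, 3 * \<kappa> (q$1) * v$2])"
    unfolding x_differential[OF q] g_def L_N[OF s]
    by (simp add: push_def algebra_simps)
  finally show ?thesis .
qed

text \<open>A warped product: pushing keeps unit length, \<open>V\<close> is a unit vector
  orthogonal to the pushed tangent, and the warping factor is \<open>u / 4\<close>.\<close>

lemma metric:
  assumes q: "q \<in> U"
  shows "induced_metric \<rho> x q v w = v$1 * w$1 + (u (q$1) / 4)\<^sup>2 * (v$2 * w$2)"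
proof -
  have s: "q$1 \<in> J" using q by (simp add: sweep_domain_def)
  have "form \<rho> (push (q$2) (T (q$1))) (push (q$2) (T (q$1))) = 1"
    by (simp add: push_form B0_T T_unit s)
  then show ?thesis
    unfolding induced_metric_def x_differential[OF q]
    by (simp add: push_V B0_T s form_commute[of \<rho> "V (q$2)" "push _ _"] W_forms power2_eq_square)
qed

lemma x_inj:
  assumes q: "q \<in> U"
  shows "inj (differential x q)"
proof -
  have s: "q$1 \<in> J" using q by (simp add: sweep_domain_def)
  have "linear (differential x q)"
    using smooth_on_has_derivative[OF smooth_x q] has_derivative_linear by blast
  moreover have "v = 0" if "differential x q v = 0" for v
  proof -
    have "induced_metric \<rho> x q v v = 0" using that by (simp add: induced_metric_def)
    then have "(v$1)\<^sup>2 + (u (q$1) / 4 * v$2)\<^sup>2 = 0"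
      by (simp add: metric q power2_eq_square mult_ac)
    then show ?thesis using u_pos[OF s] by (simp add: vec_eq_iff forall_2 sum_power2_eq_zero_iff)
  qed
  ultimately show ?thesis using linear_injective_0 by blast
qed

lemma immersed: "immersed_surface \<rho> U x"
  by (simp add: immersed_surface_def open_U smooth_x x_in x_inj)

lemma unit_normal_\<eta>: "unit_normal \<rho> U x \<eta>"
  unfolding unit_normal_def
proof (intro conjI ballI allI smooth_\<eta>)
  fix q assume q: "q \<in> U"
  then have s: "q$1 \<in> J" by (simp add: sweep_domain_def)
  show "form \<rho> (\<eta> q) (\<eta> q) = 1"
    by (simp add: \<eta>_push q push_form B0_N N_unit s)
  show "form \<rho> (\<eta> q) (differential x q v) = 0" for v
    by (simp add: \<eta>_push q x_differential push_form push_V B0_N B0_T N_T s)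
  show "\<eta> q \<in> tangent \<rho> (x q)"
  proof (cases "\<rho> = 0")
    case True
    have "form \<rho> (axis 4 1) z = 0" if "form \<rho> z (conormal \<rho> (\<gamma> r)) = 0" for z r
      using that True by (simp add: conormal_def form_commute)
    note c = this[OF N_tangent[OF s]] this[OF B0_conormal[OF s]]
    have "form \<rho> (axis 4 1) L = 0"
      using L_conormal True by (simp add: conormal_def form_commute)
    then have "form \<rho> (axis 4 1) (\<eta> q) = 0"
      by (simp add: \<eta>_def W_def c)
    then show ?thesis
      unfolding tangent_iff_conormal conormal_def using True by (simp add: form_commute)
  next
    case False
    have orth: "form \<rho> B0 (\<gamma> (q$1)) = 0" "form \<rho> (N (q$1)) (\<gamma> (q$1)) = 0"
      using B0_conormal[OF s] N_tangent[OF s] False by (simp_all add: conormal_def)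
    have "\<rho> * form \<rho> L (\<gamma> (q$1)) = \<rho> * (u (q$1) / 4)" using \<rho>_L_\<gamma>[OF s] by simp
    then have "form \<rho> L (\<gamma> (q$1)) = u (q$1) / 4" using False mult_left_cancel by blast
    \<comment> \<open>For nonzero \<open>\<rho>\<close> the position vector itself is pushed, so
      orthogonality of \<open>N\<close> to it is carried along the orbit.\<close>
    then have "x q = push (q$2) (\<gamma> (q$1))" by (simp add: x_eq q push_def)
    then show ?thesis
      using False by (simp add: tangent_def \<eta>_push q push_form B0_N s orth)
  qed
qed

lemma shape:
  assumes q: "q \<in> U"
  shows "shape_operator \<rho> x \<eta> q v = vector [- \<kappa> (q$1) * v$1, 3 * \<kappa> (q$1) * v$2]"
proof -
  have "form \<rho> (differential x q v) (\<eta> q) = 0"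
    using unit_normal_\<eta> q by (simp add: unit_normal_def form_commute)
  then have "shape_operator \<rho> x \<eta> q v =
      (THE w. differential x q w = differential x q (vector [- \<kappa> (q$1) * v$1, 3 * \<kappa> (q$1) * v$2]))"
    by (simp add: shape_operator_def covariant_def \<eta>_differential q)
  also have "\<dots> = vector [- \<kappa> (q$1) * v$1, 3 * \<kappa> (q$1) * v$2]"
    using x_inj[OF q] by (intro the_equality) (auto dest: injD)
  finally show ?thesis .
qed

lemma principal:
  assumes q: "q \<in> U"
  shows "principal_curvatures \<rho> x \<eta> q (- \<kappa> (q$1)) (3 * \<kappa> (q$1))"
proof -
  have s: "q$1 \<in> J" using q by (simp add: sweep_domain_def)
  show ?thesis
    unfolding principal_curvatures_def
    by (rule exI[of _ "vector [1, 0]"], rule exI[of _ "vector [0, 4 / u (q$1)]"])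
       (use u_pos[OF s] in \<open>simp add: metric shape q vec_eq_iff forall_2 power2_eq_square\<close>)
qed

lemma mean_curvature_eq:
  assumes q: "q \<in> U"
  shows "mean_curvature \<rho> x \<eta> q = \<kappa> (q$1)"
  by (simp add: mean_curvature_def trace_def sum_2 matrix_def shape q axis_def)

lemma gradient:
  assumes q: "q \<in> U"
  shows "surface_grad \<rho> x (mean_curvature \<rho> x \<eta>) q = vector [deriv \<kappa> (q$1), 0]"
proof -
  have s: "q$1 \<in> J" using q by (simp add: sweep_domain_def)
  have "((\<lambda>q. \<kappa> (q$1)) has_derivative (\<lambda>v. v$1 *\<^sub>R deriv \<kappa> (q$1))) (at q)"
    by (rule chain_coordinate)
       (use smooth_on_real_derivative[OF smooth_\<kappa> s] in
         \<open>simp add: has_real_derivative_iff_has_vector_derivative\<close>)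
  then have "(mean_curvature \<rho> x \<eta> has_derivative (\<lambda>v. v$1 *\<^sub>R deriv \<kappa> (q$1))) (at q)"
    by (rule has_derivative_transform_within_open[OF _ open_U q]) (simp add: mean_curvature_eq)
  then have d: "differential (mean_curvature \<rho> x \<eta>) q v = v$1 * deriv \<kappa> (q$1)" for v
    by (simp add: frechet_derivative_at[symmetric])
  show ?thesis
    unfolding surface_grad_def
  proof (rule the_equality)
    show "\<forall>v. induced_metric \<rho> x q (vector [deriv \<kappa> (q$1), 0]) v = differential (mean_curvature \<rho> x \<eta>) q v"
      by (simp add: metric q d)
  next
    fix w assume w: "\<forall>v. induced_metric \<rho> x q w v = differential (mean_curvature \<rho> x \<eta>) q v"
    show "w = vector [deriv \<kappa> (q$1), 0]"
      using w[rule_format, of "vector [1, 0]"] w[rule_format, of "vector [0, 1]"] u_pos[OF s]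
      by (simp add: metric q d vec_eq_iff forall_2)
  qed
qed

lemma biconservative_\<eta>: "biconservative \<rho> U x \<eta>"
  by (simp add: biconservative_def Let_def mean_curvature_eq gradient shape vec_eq_iff forall_2)

lemma not_CMC:
  assumes "\<not> \<kappa> constant_on J"
  shows "\<not> CMC \<rho> U x \<eta>"
proof
  assume "CMC \<rho> U x \<eta>"
  then obtain c where c: "\<And>q. q \<in> U \<Longrightarrow> mean_curvature \<rho> x \<eta> q = c"
    unfolding CMC_def constant_on_def by blast
  have "\<kappa> s = c" if "s \<in> J" for s
    using c[of "vector [s, 0]"] mean_curvature_eq[of "vector [s, 0]"] that by (simp add: sweep_domain_def)
  then show False using assms by (auto simp: constant_on_def)
qed

lemma sweep_image: "x ` U = swept_surface J \<gamma> \<phi>"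
proof
  show "swept_surface J \<gamma> \<phi> \<subseteq> x ` U"
  proof
    fix p assume "p \<in> swept_surface J \<gamma> \<phi>"
    then obtain s t where "s \<in> J" "p = \<phi> t (\<gamma> s)" by (auto simp: swept_surface_def)
    then show "p \<in> x ` U"
      by (intro image_eqI[of _ _ "vector [s, t]"]) (auto simp: sweep_def sweep_domain_def)
  qed
qed (auto simp: swept_surface_def sweep_def sweep_domain_def)

lemma surface_conclusion:
  assumes "\<not> \<kappa> constant_on J"
  shows "\<exists>\<eta> k1 k2. unit_normal \<rho> U x \<eta> \<and> linear_weingarten \<rho> U x \<eta> k1 k2
    \<and> (\<forall>q\<in>U. 3 * k1 q + k2 q = 0 \<and> k1 q = - \<kappa> (q$1))
    \<and> biconservative \<rho> U x \<eta> \<and> \<not> CMC \<rho> U x \<eta>"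
proof (intro exI conjI)
  show "linear_weingarten \<rho> U x \<eta> (\<lambda>q. - \<kappa> (q$1)) (\<lambda>q. 3 * \<kappa> (q$1))"
    unfolding linear_weingarten_def by (auto intro: principal exI[of _ "- 1/3"])
qed (use unit_normal_\<eta> biconservative_\<eta> not_CMC[OF assms] in auto)

end


section \<open>Rotations about the axis\<close>

locale rotational_curve = extremal_curve +
  assumes m_pos: "0 < m"
begin

text \<open>The length of the part of \<open>4 *\<^sub>R L\<close> tangent at
  \<open>\<gamma> s0\<close>; \<open>w\<close> below is the unit vector in its direction, along
  which \<open>\<beta>\<close> grows fastest, and \<open>e\<close> is orthogonal to it within the
  surface of the curve.\<close>

definition n :: real where "n = sqrt ((deriv u s0)\<^sup>2 + 9 * (\<kappa> s0)\<^sup>2 * (u s0)\<^sup>2)"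

definition w :: "real^4" where
  "w = (1 / n) *\<^sub>R (deriv u s0 *\<^sub>R T s0 + (3 * \<kappa> s0 * u s0) *\<^sub>R N s0)"

definition e :: "real^4" where
  "e = (1 / n) *\<^sub>R ((3 * \<kappa> s0 * u s0) *\<^sub>R T s0 - deriv u s0 *\<^sub>R N s0)"

text \<open>
  The point \<open>p0\<close> is the foot of the perpendicular from \<open>\<gamma> s0\<close> to the axis, and \<open>e\<close> the direction of
  the axis there.
\<close>

definition p0 :: "real^4" where "p0 = (1 / (4 * sqrt m)) *\<^sub>R (n *\<^sub>R \<gamma> s0 - u s0 *\<^sub>R w)"

definition axis_curve :: "real \<Rightarrow> real^4" where
  "axis_curve t = (1 - \<rho> * gver \<rho> t) *\<^sub>R p0 + gsin \<rho> t *\<^sub>R e"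

lemma n_pos: "0 < n" and n_square: "n\<^sup>2 = (deriv u s0)\<^sup>2 + (3 * \<kappa> s0 * u s0)\<^sup>2"
proof -
  have "0 < 3 * \<kappa> s0 * u s0" using curvature_pos[OF s0] u_pos[OF s0] by simp
  then have "0 < (deriv u s0)\<^sup>2 + (3 * \<kappa> s0 * u s0)\<^sup>2"
    by (intro add_nonneg_pos) auto
  then show "0 < n" "n\<^sup>2 = (deriv u s0)\<^sup>2 + (3 * \<kappa> s0 * u s0)\<^sup>2"
    by (simp_all add: n_def power_mult_distrib)
qed

text \<open>After division by \<open>16 * m\<close> this is the conic relation for the generalised
  cosine \<open>n / (4 * sqrt m)\<close> and sine \<open>u s0 / (4 * sqrt m)\<close>. Hence
  \<open>p0\<close> lies on the geodesic from \<open>\<gamma> s0\<close> in the direction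
  \<open>- w\<close>, at the place where \<open>\<beta>\<close> vanishes.\<close>

lemma m_n: "16 * m = n\<^sup>2 + \<rho> * (u s0)\<^sup>2"
  unfolding m_eq first_integral_eq[OF s0] n_square by (simp add: power_mult_distrib)

lemma flat_ratio: "\<rho> = 0 \<Longrightarrow> n / (4 * sqrt m) = 1"
proof -
  assume "\<rho> = 0"
  then have "(4 * sqrt m)\<^sup>2 = n\<^sup>2" using m_n m_pos by (simp add: power_mult_distrib)
  then have "4 * sqrt m = n" using n_pos m_pos
    by (intro power2_eq_imp_eq[of "4 * sqrt m" n]) (simp_all add: less_imp_le)
  then have "n / (4 * sqrt m) = n / n" by (rule arg_cong)
  then show ?thesis using n_pos by simp
qed

lemma w_e_forms:
  shows "form \<rho> w w = 1" "form \<rho> e e = 1" "form \<rho> e w = 0" "form \<rho> L w = n / 4" "form \<rho> L e = 0"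
    "form \<rho> B0 w = 0" "form \<rho> B0 e = 0"
    "form \<rho> w (conormal \<rho> (\<gamma> s0)) = 0" "form \<rho> e (conormal \<rho> (\<gamma> s0)) = 0"
proof -
  define a c where "a = deriv u s0" and "c = 3 * \<kappa> s0 * u s0"
  have ac: "a\<^sup>2 + c\<^sup>2 = n\<^sup>2" using n_square by (simp add: a_def c_def)
  have L: "form \<rho> L (T s0) = a / 4" "form \<rho> L (N s0) = c / 4"
    by (simp_all add: L_T L_N s0 a_def c_def)
  have w: "w = (1 / n) *\<^sub>R (a *\<^sub>R T s0 + c *\<^sub>R N s0)" and e: "e = (1 / n) *\<^sub>R (c *\<^sub>R T s0 - a *\<^sub>R N s0)"
    by (simp_all add: w_def e_def a_def c_def)
  note forms = T_unit N_unit T_N N_T B0_T B0_N T_tangent N_tangent s0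
  have "form \<rho> w w = (a\<^sup>2 + c\<^sup>2) / n\<^sup>2" "form \<rho> e e = (a\<^sup>2 + c\<^sup>2) / n\<^sup>2"
    "form \<rho> L w = (a\<^sup>2 + c\<^sup>2) / n / 4"
    by (simp_all add: w e forms L power2_eq_square add_divide_distrib)
  then show "form \<rho> w w = 1" "form \<rho> e e = 1" "form \<rho> L w = n / 4"
    unfolding ac using n_pos by (simp_all add: power2_eq_square)
  show "form \<rho> e w = 0" "form \<rho> L e = 0" "form \<rho> B0 w = 0" "form \<rho> B0 e = 0"
    "form \<rho> w (conormal \<rho> (\<gamma> s0)) = 0" "form \<rho> e (conormal \<rho> (\<gamma> s0)) = 0"
    by (simp_all add: w e forms L)
qed

lemma p0_in: "p0 \<in> space_form \<rho>"
proof (cases "\<rho> = 0")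
  case True
  have "form 0 w (axis 4 1) = 0"
    using w_e_forms(8) True by (simp add: conormal_def)
  then have "w $ 4 = 0" by (simp add: form_axis)
  moreover have "\<gamma> s0 $ 4 = 1" using \<gamma>_in[OF s0] True by (simp add: space_form_flat)
  ultimately have "p0 $ 4 = 1" using flat_ratio[OF True] n_pos by (simp add: p0_def)
  then show ?thesis using True by (simp add: space_form_flat)
next
  case False
  have wg: "form \<rho> w (\<gamma> s0) = 0" "form \<rho> (\<gamma> s0) w = 0"
    using w_e_forms(8) False by (simp_all add: conormal_def form_commute)
  have gg: "form \<rho> (\<gamma> s0) (\<gamma> s0) = 1 / \<rho>"
    using space_form_norm[OF \<gamma>_in[OF s0] False] False by (simp add: field_simps)
  have "form \<rho> p0 p0 = (n\<^sup>2 / \<rho> + (u s0)\<^sup>2) / (16 * m)"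
    using m_pos by (simp add: p0_def wg gg w_e_forms power2_eq_square field_simps)
  also have "n\<^sup>2 / \<rho> + (u s0)\<^sup>2 = 16 * m / \<rho>"
    using False by (simp add: m_n add_divide_distrib)
  also have "\<dots> / (16 * m) = 1 / \<rho>"
    using m_pos by simp
  finally have pp: "form \<rho> p0 p0 = 1 / \<rho>" .
  show ?thesis
  proof (cases "\<rho> < 0")
    case True
    have "form \<rho> p0 (\<gamma> s0) = n / (4 * sqrt m) / \<rho>"
      by (simp add: p0_def wg gg)
    also have "\<dots> < 0" using True n_pos m_pos by (intro divide_pos_neg) simp_all
    finally show ?thesis using hyperbolic_same_sheet[OF True \<gamma>_in[OF s0] pp] by simp
  qed (use False pp in \<open>simp add: space_form_def\<close>)
qed

lemma e_tangent: "e \<in> tangent \<rho> p0"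
proof (cases "\<rho> = 0")
  case True
  then have "form 0 e (axis 4 1) = 0" using w_e_forms(9) by (simp add: conormal_def)
  then show ?thesis using True by (simp add: tangent_def form_axis)
next
  case False
  then have "form \<rho> e (\<gamma> s0) = 0" using w_e_forms(9) by (simp add: conormal_def)
  then show ?thesis using False by (simp add: tangent_def p0_def w_e_forms)
qed

lemmas axis_geodesic = geodesic_formula[OF p0_in e_tangent w_e_forms(2), folded axis_curve_def]

lemma L_\<gamma>0: "\<rho> \<noteq> 0 \<Longrightarrow> form \<rho> L (\<gamma> s0) = u s0 / 4"
proof -
  assume "\<rho> \<noteq> 0"
  moreover have "\<rho> * form \<rho> L (\<gamma> s0) = \<rho> * (u s0 / 4)" using \<rho>_L_\<gamma>0 by simp
  ultimately show ?thesis using mult_left_cancel by blast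
qed

lemma p0_forms:
  "\<alpha> p0 = 0" "\<beta> p0 = 0" "\<rho> \<noteq> 0 \<Longrightarrow> form \<rho> B0 p0 = 0" "\<rho> \<noteq> 0 \<Longrightarrow> form \<rho> L p0 = 0"
proof -
  let ?k = "n / (4 * sqrt m)"
  have B: "form \<rho> B0 p0 = ?k * form \<rho> B0 (\<gamma> s0)"
    by (simp add: p0_def w_e_forms)
  have L: "form \<rho> L p0 = ?k * (form \<rho> L (\<gamma> s0) - u s0 / 4)"
    by (simp add: p0_def w_e_forms algebra_simps)
  have B\<gamma>: "form \<rho> B0 (\<gamma> s0) = 0" if "\<rho> \<noteq> 0"
    using B0_conormal[OF s0] that by (simp add: conormal_def)
  show "\<rho> \<noteq> 0 \<Longrightarrow> form \<rho> B0 p0 = 0" "\<rho> \<noteq> 0 \<Longrightarrow> form \<rho> L p0 = 0"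
    using B L B\<gamma> L_\<gamma>0 by auto
  have "\<alpha> p0 = (?k - 1) * form \<rho> B0 (\<gamma> s0)" "\<beta> p0 = (?k - 1) * (form \<rho> L (\<gamma> s0) - u s0 / 4)"
    unfolding \<alpha>_def \<beta>_def B L by (simp_all only: left_diff_distrib mult_1_left right_diff_distrib)
  moreover have "?k - 1 = 0" if "\<rho> = 0"
    using flat_ratio[OF that] by (simp only: diff_self)
  moreover have "form \<rho> B0 (\<gamma> s0) = 0" "form \<rho> L (\<gamma> s0) - u s0 / 4 = 0" if "\<rho> \<noteq> 0"
    using B\<gamma>[OF that] L_\<gamma>0[OF that] by simp_all
  ultimately show "\<alpha> p0 = 0" "\<beta> p0 = 0"
    by (cases "\<rho> = 0", simp_all only: mult_zero_left mult_zero_right not_False_eq_True)+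
qed

lemma axis_\<alpha>: "\<alpha> (axis_curve t) = 0" and axis_\<beta>: "\<beta> (axis_curve t) = 0"
proof -
  have z: "\<rho> * form \<rho> B0 p0 = 0" "\<rho> * form \<rho> L p0 = 0"
    using p0_forms by auto
  have "form \<rho> v (axis_curve t) = form \<rho> v p0 - gver \<rho> t * (\<rho> * form \<rho> v p0) + gsin \<rho> t * form \<rho> v e" for v
    by (simp add: axis_curve_def algebra_simps)
  then have "form \<rho> B0 (axis_curve t) = form \<rho> B0 p0" "form \<rho> L (axis_curve t) = form \<rho> L p0"
    by (simp_all only: z w_e_forms mult_zero_right diff_0_right add_0_right)
  then show "\<alpha> (axis_curve t) = 0" "\<beta> (axis_curve t) = 0"
    using p0_forms(1,2) by (simp_all add: \<alpha>_def \<beta>_def)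
qed

definition \<zeta> :: "(real^4) set" where "\<zeta> = range axis_curve"

lemma geodesic_\<zeta>: "geodesic \<rho> \<zeta>"
proof -
  define c' where "c' t = (- \<rho> * gsin \<rho> t) *\<^sub>R p0 + (1 - \<rho> * gver \<rho> t) *\<^sub>R e" for t
  note g = axis_geodesic[folded c'_def]
  have v: "vector_derivative axis_curve (at t) = c' t" for t
    using g(4) by (simp add: vector_derivative_at)
  have "vector_derivative c' (at t) = - \<rho> *\<^sub>R axis_curve t" for t
    using g(5) by (simp add: vector_derivative_at)
  then have "covariant_along \<rho> axis_curve (velocity axis_curve) t = 0" for t
    unfolding covariant_along_def covariant_def v using g(3) by simp
  moreover have "smooth_on UNIV axis_curve"
    unfolding axis_curve_def[abs_def]
    by (intro smooth_on_add smooth_on_scaleR smooth_on_diff smooth_on_mult smooth_on_const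
        smooth_on_gsin smooth_on_gver)
  ultimately show ?thesis
    unfolding geodesic_def \<zeta>_def arclength_curve_def
    by (intro exI[of _ axis_curve] conjI) (use v g in \<open>auto simp: is_interval_univ\<close>)
qed

section \<open>Normal planes of the axis, and orbits as sets of given distances\<close>

lemma L_flat: "\<rho> = 0 \<Longrightarrow> form \<rho> L (axis 4 1) = 0" and B0_flat: "\<rho> = 0 \<Longrightarrow> form \<rho> B0 (axis 4 1) = 0"
  using L_conormal B0_conormal[OF s0] by (simp_all add: conormal_def)

lemma orthogonal_plane:
  assumes "form \<rho> d e = 0" "form \<rho> d (conormal \<rho> p0) = 0"
  shows "d = form \<rho> d B0 *\<^sub>R B0 + (form \<rho> d L / m) *\<^sub>R L"
proof -
  have c: "form \<rho> B0 (conormal \<rho> p0) = 0" "form \<rho> L (conormal \<rho> p0) = 0"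
    using p0_forms(3,4) L_flat B0_flat by (auto simp: conormal_def)
  have c': "form \<rho> e (conormal \<rho> p0) = 0"
    using e_tangent by (simp add: tangent_iff_conormal)
  have "d - (form \<rho> d B0 *\<^sub>R B0 + (form \<rho> d L / m) *\<^sub>R L) = 0"
    by (rule orthogonal_to_frame[where \<rho> = \<rho> and a = B0 and b = L and c = e and d = "conormal \<rho> p0"])
       (use m_pos in \<open>simp_all add: assms c c' B0_L L_B0 L_L B0_unit w_e_forms conormal_square[OF p0_in]\<close>)
  then show ?thesis by simp
qed

lemma axis_derivative: "(axis_curve has_vector_derivative e) (at 0)"
  using axis_geodesic(4)[of 0] by simp

lemma axis_0: "axis_curve 0 = p0"
  by (simp add: axis_curve_def)

lemma orthogonal_e:
  assumes "\<And>t. form \<rho> d (axis_curve t) = form \<rho> d p0"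
  shows "form \<rho> d e = 0"
  using form_const_has_derivative[OF axis_derivative, of \<rho> d]
    DERIV_unique[of "\<lambda>t. form \<rho> d (axis_curve t)" _ 0 0] DERIV_const[of "form \<rho> d p0" "at 0"]
  by (simp add: assms)

text \<open>The last assumption is the expanded statement that \<open>p\<close> and \<open>q\<close>
  are equally far from \<open>p0\<close>.\<close>

lemma conormal_difference:
  assumes "p \<in> space_form \<rho>" "q \<in> space_form \<rho>"
    "form \<rho> (q - p) (q - p) + 2 * form \<rho> (q - p) (p - p0) = 0"
  shows "form \<rho> (q - p) (conormal \<rho> p0) = 0"
proof (cases "\<rho> = 0")
  case True
  then show ?thesis using assms(1,2) by (simp add: conormal_def form_axis space_form_flat)
next
  case False
  then have "form \<rho> p p = form \<rho> q q"
    using space_form_norm[OF assms(1)] space_form_norm[OF assms(2)] False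
    by (metis mult_left_cancel)
  then have "form \<rho> (q - p) p0 = 0"
    using assms(3) by (simp add: form_commute[of \<rho> q p])
  then show ?thesis using False by (simp add: conormal_def)
qed

text \<open>Equal distances to all points of the axis make the difference \<open>d\<close>
  orthogonal to the axis, hence a combination of \<open>B0\<close> and \<open>L\<close>. The
  distance to \<open>p0\<close> then leaves a conic for the two coefficients, which the orbit
  parametrises.\<close>

lemma orbit_eq:
  assumes s: "s \<in> J" and y: "y \<in> space_form \<rho>"
    and dist: "\<And>t. form \<rho> (y - axis_curve t) (y - axis_curve t)
      = form \<rho> (\<gamma> s - axis_curve t) (\<gamma> s - axis_curve t)"
  shows "\<exists>t. y = \<phi> t (\<gamma> s)"
proof -
  define d where "d = y - \<gamma> s"
  define k where "k = u s / 4"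
  have k: "k > 0" using u_pos[OF s] by (simp add: k_def)
  have eq: "form \<rho> d d + 2 * form \<rho> d (\<gamma> s - axis_curve t) = 0" for t
  proof -
    have "y - axis_curve t = d + (\<gamma> s - axis_curve t)" by (simp add: d_def)
    then have "form \<rho> (y - axis_curve t) (y - axis_curve t) =
        form \<rho> d d + 2 * form \<rho> d (\<gamma> s - axis_curve t)
        + form \<rho> (\<gamma> s - axis_curve t) (\<gamma> s - axis_curve t)"
      by (simp only: form_linear(1,2) form_commute[of \<rho> "\<gamma> s - axis_curve t" d])
    then show ?thesis using dist[of t] by simp
  qed
  have "form \<rho> d (axis_curve t) = form \<rho> d p0" for t
    using eq[of t] eq[of 0] by (simp add: axis_0)
  then have de: "form \<rho> d e = 0" by (rule orthogonal_e)
  have dc: "form \<rho> d (conormal \<rho> p0) = 0"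
    using conormal_difference[OF \<gamma>_in[OF s] y] eq[of 0] by (simp add: d_def axis_0)
  define a b where "a = form \<rho> d B0" and "b = form \<rho> d L / m"
  have d_eq: "d = a *\<^sub>R B0 + b *\<^sub>R L"
    unfolding a_def b_def by (rule orthogonal_plane[OF de dc])
  have dd: "form \<rho> d d = a\<^sup>2 + m * b\<^sup>2"
    by (simp add: d_eq B0_unit B0_L L_B0 L_L power2_eq_square)
  have "form \<rho> d (\<gamma> s - p0) = a * form \<rho> B0 (\<gamma> s - p0) + b * form \<rho> L (\<gamma> s - p0)"
    unfolding d_eq by (simp only: form_linear(1,7))
  also have "\<dots> = b * k"
    unfolding \<alpha>_diff \<beta>_diff by (simp add: \<alpha>_curve \<beta>_curve s p0_forms k_def)
  finally have rel: "a\<^sup>2 + m * b\<^sup>2 + 2 * b * k = 0"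
    using eq[of 0] dd by (simp add: axis_0 del: form_linear)
  \<comment> \<open>Completing the square and scaling by \<open>k\<close> brings the conic into the
    normal form of \<open>gsin_gver_attain\<close>; as \<open>m > 0\<close>, all of it is
    attained.\<close>
  have "(1 + m * b / k)\<^sup>2 + m * (a / k)\<^sup>2 = 1 + m * (a\<^sup>2 + m * b\<^sup>2 + 2 * b * k) / k\<^sup>2"
    using k by (simp add: power2_eq_square field_simps)
  also have "\<dots> = 1" unfolding rel by simp
  finally obtain t where t: "gsin m t = a / k" "1 - m * gver m t = 1 + m * b / k"
    using gsin_gver_attain[of "1 + m * b / k" m "a / k"] m_pos by auto
  then have "gver m t = - (b / k)"
  proof -
    have "m * gver m t = m * - (b / k)" using t(2) by simp
    then show ?thesis using m_pos by (metis mult_left_cancel less_irrefl)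
  qed
  then have "d = k *\<^sub>R W t"
    using t(1) k by (simp add: d_eq W_def algebra_simps)
  then have "y = \<phi> t (\<gamma> s)"
    by (simp add: flow_curve s d_def k_def algebra_simps)
  then show ?thesis ..
qed

section \<open>Explicit rotations that move the curve as the flow does\<close>

definition E :: "real \<Rightarrow> real^4 \<Rightarrow> real^4" where
  "E t v = v + form \<rho> L v *\<^sub>R W t + form \<rho> B0 v *\<^sub>R (V t - B0)"

text \<open>The result of integrating the affine field \<open>X\<close> over the whole ambient
  space, with linear part \<open>E t\<close>. Being affine, it has an evident derivative; its
  agreement with \<open>\<phi>\<close> is established on the curve.\<close>

definition R :: "real \<Rightarrow> real^4 \<Rightarrow> real^4" where
  "R t p = p + \<beta> p *\<^sub>R W t + \<alpha> p *\<^sub>R (V t - B0)"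

lemma R_diff: "R t p - R t q = E t (p - q)"
  unfolding R_def E_def \<alpha>_diff \<beta>_diff by (simp add: algebra_simps)

lemma linear_E: "linear (E t)"
  by (rule linearI) (simp_all add: E_def algebra_simps)

lemma form_W: "form \<rho> v (W t) = gsin m t * form \<rho> B0 v - gver m t * form \<rho> L v"
  and form_V: "form \<rho> v (V t) = (1 - m * gver m t) * form \<rho> B0 v - gsin m t * form \<rho> L v"
  by (simp_all add: W_def V_def form_commute[of \<rho> v])

lemma E_form: "form \<rho> (E t v) (E t z) = form \<rho> v z"
  by (simp add: E_def form_commute[of \<rho> "W t" z] form_commute[of \<rho> "V t" z]
      form_commute[of \<rho> "V t" "W t"] form_commute[of \<rho> "W t" B0] form_commute[of \<rho> "V t" B0]
      form_commute[of \<rho> v B0] form_W[of v] form_W[of z] form_V[of v] form_V[of z] W_forms B0_unit)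
     (simp add: algebra_simps)

lemma inj_E: "inj (E t)"
proof -
  have "v = 0" if "E t v = 0" for v
    by (rule form_nondegenerate[of \<rho>]) (metis E_form form_linear(9) that)
  then show ?thesis using linear_injective_0[OF linear_E] by blast
qed

lemma E_expand:
  "E t v = v + (gsin m t * form \<rho> L v - m * gver m t * form \<rho> B0 v) *\<^sub>R B0
    - (gver m t * form \<rho> L v + gsin m t * form \<rho> B0 v) *\<^sub>R L"
  by (simp add: E_def W_def V_def algebra_simps)

text \<open>Provides a square root of \<open>E t\<close>, so that its determinant is a square and
  thus positive, without a continuity argument in \<open>t\<close>. Facts \<open>1\<close> and
  \<open>2\<close> compare the coefficients of \<open>B0\<close> and \<open>L\<close> by means of
  the duplication formulas.\<close>

lemma E_half: "E t v = E (t / 2) (E (t / 2) v)"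
proof -
  define S Q where "S = gsin m (t / 2)" and "Q = gver m (t / 2)"
  define l b where "l = form \<rho> L v" and "b = form \<rho> B0 v"
  define l' b' where "l' = form \<rho> L (E (t / 2) v)" and "b' = form \<rho> B0 (E (t / 2) v)"
  have S2: "S\<^sup>2 = 2 * Q - m * Q\<^sup>2" unfolding S_def Q_def by (rule conic)
  have l': "l' = l * (1 - m * Q) - m * S * b" and b': "b' = l * S + b * (1 - m * Q)"
    by (simp_all add: E_expand l'_def b'_def l_def b_def S_def Q_def B0_unit B0_L L_B0 L_L algebra_simps)
  have 1: "(2 * S * (1 - m * Q)) * l - m * (2 * S\<^sup>2) * b = (S * l - m * Q * b) + (S * l' - m * Q * b')"
    unfolding l' b' using S2 by algebra
  have 2: "(2 * S\<^sup>2) * l + (2 * S * (1 - m * Q)) * b = (Q * l + S * b) + (Q * l' + S * b')"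
    unfolding l' b' using S2 by algebra
  have "E t v = v + ((2 * S * (1 - m * Q)) * l - m * (2 * S\<^sup>2) * b) *\<^sub>R B0
      - ((2 * S\<^sup>2) * l + (2 * S * (1 - m * Q)) * b) *\<^sub>R L"
    unfolding E_expand gsin_gver_half[of m t] S_def Q_def l_def b_def ..
  also have "\<dots> = E (t / 2) v + (S * l' - m * Q * b') *\<^sub>R B0 - (Q * l' + S * b') *\<^sub>R L"
    unfolding 1 2 E_expand[of "t / 2" v] scaleR_add_left
    by (simp add: S_def Q_def l_def b_def)
  also have "\<dots> = E (t / 2) (E (t / 2) v)"
    unfolding E_expand[of "t / 2" "E (t / 2) v"] S_def Q_def l'_def b'_def ..
  finally show ?thesis .
qed

lemma det_E_pos: "0 < det (matrix (E t))"
proof -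
  have "E t = E (t / 2) \<circ> E (t / 2)"
    by (simp add: fun_eq_iff E_half[of t])
  then have "det (matrix (E t)) = (det (matrix (E (t / 2))))\<^sup>2"
    by (simp add: matrix_compose linear_E det_mul power2_eq_square)
  moreover have "det (matrix (E (t / 2))) \<noteq> 0"
    using det_nz_iff_inj[OF linear_E] inj_E by blast
  ultimately show ?thesis by simp
qed

lemma R_axis: "R t (axis_curve r) = axis_curve r"
  by (simp add: R_def axis_\<alpha> axis_\<beta>)

lemma R_curve: "s \<in> J \<Longrightarrow> R t (\<gamma> s) = \<phi> t (\<gamma> s)"
  by (simp add: R_def \<alpha>_curve \<beta>_curve flow_curve)

lemma R_curved: "\<rho> \<noteq> 0 \<Longrightarrow> R t p = E t p"
proof -
  assume "\<rho> \<noteq> 0"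
  then have "\<alpha> p = form \<rho> B0 p" "\<beta> p = form \<rho> L p"
    using \<alpha>_diff[of p p0] \<beta>_diff[of p p0] p0_forms by simp_all
  then show ?thesis by (simp add: R_def E_def)
qed

lemma E_flat: "\<rho> = 0 \<Longrightarrow> E t v $ 4 = v $ 4" and E_axis4: "\<rho> = 0 \<Longrightarrow> E t (axis 4 1) = axis 4 1"
proof -
  assume "\<rho> = 0"
  then have "L $ 4 = 0" "B0 $ 4 = 0" using L_flat B0_flat by (simp_all add: form_axis)
  then show "E t v $ 4 = v $ 4" by (simp add: E_expand)
  show "E t (axis 4 1) = axis 4 1" 
    unfolding E_def L_flat[OF \<open>\<rho> = 0\<close>] B0_flat[OF \<open>\<rho> = 0\<close>] by simp
qed

lemma R_in_iff: "R t p \<in> space_form \<rho> \<longleftrightarrow> p \<in> space_form \<rho>"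
proof (cases "\<rho> = 0")
  case True
  have "R t p = E t (p - p0) + p0"
    using R_diff[of t p p0] R_axis[of t 0] by (simp add: axis_0 algebra_simps)
  then have "R t p $ 4 = (p - p0) $ 4 + p0 $ 4"
    by (simp only: vector_add_component E_flat[OF True])
  then have "R t p $ 4 = p $ 4" by simp
  then show ?thesis using True by (simp add: space_form_flat)
next
  case False
  have eq: "form \<rho> (R t p) (R t p) = form \<rho> p p" by (simp add: R_curved False E_form)
  show ?thesis
  proof (cases "\<rho> < 0")
    case True
    have "form \<rho> (R t p) (R t p0) = form \<rho> p p0" by (simp add: R_curved False E_form)
    then have eq': "form \<rho> (R t p) p0 = form \<rho> p p0" using R_axis[of t 0] by (simp add: axis_0)
    have neg: "form \<rho> q p0 < 0" if "q \<in> space_form \<rho>" for q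
      using hyperbolic_form_ge[OF True that p0_in] mult_nonpos_nonneg[of \<rho> "form \<rho> q p0"] True
      by linarith
    have sq: "form \<rho> q q = 1 / \<rho>" if "q \<in> space_form \<rho>" for q
      using that True by (simp add: space_form_def)
    \<comment> \<open>The sheet is recognised by the product with the fixed point \<open>p0\<close>,
      which \<open>R t\<close> preserves.\<close>
    have iff: "q \<in> space_form \<rho> \<longleftrightarrow> form \<rho> q q = 1 / \<rho> \<and> form \<rho> q p0 < 0" for q
      using neg sq hyperbolic_same_sheet[OF True p0_in] by blast
    show ?thesis
      unfolding iff eq eq' ..
  qed (use eq False in \<open>simp add: space_form_def\<close>)
qed

lemma isometry_R: "isometry \<rho> (R t)"
  unfolding isometry_def
proof (intro conjI ballI)
  show "bij_betw (R t) (space_form \<rho>) (space_form \<rho>)"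
    unfolding bij_betw_def
  proof (intro conjI set_eqI iffI)
    show "inj_on (R t) (space_form \<rho>)"
    proof (rule inj_onI)
      fix p q assume "R t p = R t q"
      then have "E t (p - q) = E t 0" using R_diff[of t p q] linear_0[OF linear_E] by simp
      then show "p = q" using injD[OF inj_E] by fastforce
    qed
    show "q \<in> space_form \<rho>" if "q \<in> R t ` space_form \<rho>" for q
      using that R_in_iff by auto
    show "q \<in> R t ` space_form \<rho>" if "q \<in> space_form \<rho>" for q
    proof -
      obtain d where d: "q - p0 = E t d"
        using linear_injective_imp_surjective[OF linear_E inj_E] by (meson surjD)
      have "R t (p0 + d) - p0 = q - p0"
        using R_diff[of t "p0 + d" p0] R_axis[of t 0] d by (simp add: axis_0)
      then have "R t (p0 + d) = q" by simp
      then show ?thesis using that R_in_iff[of t "p0 + d"] by blast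
    qed
  qed
  show "geo_dist \<rho> (R t p) (R t q) = geo_dist \<rho> p q" if "p \<in> space_form \<rho>" "q \<in> space_form \<rho>" for p q
    unfolding geo_dist_eq_iff[OF that R_in_iff[THEN iffD2, OF that(1)] R_in_iff[THEN iffD2, OF that(2)]]
    by (simp only: R_diff E_form)
qed

lemma orientation_preserving_R: "orientation_preserving \<rho> (R t)"
  unfolding orientation_preserving_def
proof (intro ballI exI conjI impI)
  fix p assume "p \<in> space_form \<rho>"
  have "R t = (\<lambda>q. E t q + (R t p - E t p))"
    using R_diff[of t _ p] linear_diff[OF linear_E] by (simp add: fun_eq_iff algebra_simps)
  moreover have "((\<lambda>q. E t q + (R t p - E t p)) has_derivative E t) (at p within space_form \<rho>)"
    by (intro has_derivative_add_const linear_imp_has_derivative linear_E)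
  ultimately show "(R t has_derivative E t) (at p within space_form \<rho>)" by simp
  fix a b c assume *: "0 < vol \<rho> p a b c"
  \<comment> \<open>The conormal is transported too, so all four rows of the volume determinant are
    multiplied by the same matrix, of positive determinant.\<close>
  have con: "conormal \<rho> (R t p) = E t (conormal \<rho> p)"
    using E_axis4[of t] R_curved[of t p] by (auto simp: conormal_def linear_scale[OF linear_E])
  have "(vector [E t a, E t b, E t c, E t (conormal \<rho> p)] :: real^4^4)
      = vector [a, b, c, conormal \<rho> p] ** transpose (matrix (E t))"
  proof -
    have "E t z $ j = (\<Sum>k\<in>UNIV. z $ k * matrix (E t) $ j $ k)" for z j
    proof -
      have "E t z = matrix (E t) *v z"
        by (rule fun_cong[OF matrix_vector_mul(2)[OF linear_E], symmetric])
      then show ?thesis by (simp add: matrix_vector_mult_def mult.commute)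
    qed
    then show ?thesis
      by (simp add: vec_eq_iff forall_4 matrix_matrix_mult_def transpose_def vector_def)
  qed
  then show "0 < vol \<rho> (R t p) (E t a) (E t b) (E t c)"
    using * det_E_pos[of t] by (simp add: vol_def con det_mul det_transpose)
qed

lemma rotation_R: "R t \<in> rotations \<rho> \<zeta>"
  by (auto simp: rotations_def isometry_R orientation_preserving_R \<zeta>_def R_axis)

text \<open>The whole information about an arbitrary rotation that is used: it fixes the points of
  the axis and preserves distances. With \<open>orbit_eq\<close> this confines it to the orbits of
  the flow.\<close>

lemma rotation_distances:
  assumes "F \<in> rotations \<rho> \<zeta>" "p \<in> space_form \<rho>"
  shows "form \<rho> (F p - axis_curve t) (F p - axis_curve t) = form \<rho> (p - axis_curve t) (p - axis_curve t)"
    "F p \<in> space_form \<rho>"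
proof -
  have F: "isometry \<rho> F" "F (axis_curve t) = axis_curve t"
    using assms(1) by (auto simp: rotations_def \<zeta>_def)
  show F_in: "F p \<in> space_form \<rho>"
    using F(1) assms(2) by (auto simp: isometry_def bij_betw_def)
  have "geo_dist \<rho> (F p) (axis_curve t) = geo_dist \<rho> p (axis_curve t)"
    using F assms(2) axis_geodesic(1)[of t] unfolding isometry_def by metis
  then show "form \<rho> (F p - axis_curve t) (F p - axis_curve t) = form \<rho> (p - axis_curve t) (p - axis_curve t)"
    by (simp only: geo_dist_eq_iff[OF assms(2) axis_geodesic(1) F_in axis_geodesic(1)])
qed

section \<open>The swept surface as a surface of revolution\<close>

lemma flow_in: "s \<in> J \<Longrightarrow> \<phi> t (\<gamma> s) \<in> space_form \<rho>"
  using flow \<gamma>_in by (simp add: flow_of_def)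

lemma flow_distances:
  assumes "s \<in> J"
  shows "form \<rho> (\<phi> t (\<gamma> s) - axis_curve r) (\<phi> t (\<gamma> s) - axis_curve r)
    = form \<rho> (\<gamma> s - axis_curve r) (\<gamma> s - axis_curve r)"
  using rotation_distances(1)[OF rotation_R \<gamma>_in[OF assms]] by (simp only: R_curve[OF assms])

abbreviation "S \<equiv> swept_surface J \<gamma> \<phi>"

lemma rotational: "rotational_about \<rho> \<zeta> S"
  unfolding rotational_about_def
proof (intro conjI geodesic_\<zeta> ballI)
  show S_in: "S \<subseteq> space_form \<rho>"
    using flow_in by (auto simp: swept_surface_def)
  fix F assume F: "F \<in> rotations \<rho> \<zeta>"
  show "F ` S = S"
  proof (intro set_eqI iffI)
    fix y assume "y \<in> F ` S"
    then obtain s t where s: "s \<in> J" and y: "y = F (\<phi> t (\<gamma> s))" by (auto simp: swept_surface_def)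
    have "\<exists>r. y = \<phi> r (\<gamma> s)"
      unfolding y by (rule orbit_eq[OF s rotation_distances(2)[OF F flow_in[OF s]]])
        (simp only: rotation_distances(1)[OF F flow_in[OF s]] flow_distances[OF s])
    then show "y \<in> S" using s by (auto simp: swept_surface_def)
  next
    fix y assume "y \<in> S"
    then obtain s t where s: "s \<in> J" and y: "y = \<phi> t (\<gamma> s)" by (auto simp: swept_surface_def)
    have "bij_betw F (space_form \<rho>) (space_form \<rho>)"
      using F by (simp add: rotations_def isometry_def)
    \<comment> \<open>The preimage exists by bijectivity and has the same distances to the axis as
      \<open>y\<close>, so it lies on the same orbit.\<close>
    then obtain q where q: "q \<in> space_form \<rho>" "y = F q"
      using flow_in[OF s, of t] y by (auto simp: bij_betw_def)
    have "\<exists>r. q = \<phi> r (\<gamma> s)"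
      by (rule orbit_eq[OF s q(1)])
         (simp only: rotation_distances(1)[OF F q(1), folded q(2), symmetric] flow_distances[OF s] y)
    then show "y \<in> F ` S" using s q(2) by (auto simp: swept_surface_def)
  qed
qed

lemma profile: "profile_curve \<rho> \<zeta> S J \<gamma>"
  unfolding profile_curve_def
proof (intro conjI ballI allI impI)
  show "S = {F (\<gamma> s) | F s. F \<in> rotations \<rho> \<zeta> \<and> s \<in> J}"
  proof (intro set_eqI iffI)
    fix y assume "y \<in> S"
    then obtain s t where "s \<in> J" "y = \<phi> t (\<gamma> s)" by (auto simp: swept_surface_def)
    then have "y = R t (\<gamma> s)" by (simp add: R_curve)
    then show "y \<in> {F (\<gamma> s) | F s. F \<in> rotations \<rho> \<zeta> \<and> s \<in> J}"
      using rotation_R \<open>s \<in> J\<close> by blast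
  next
    fix y assume "y \<in> {F (\<gamma> s) | F s. F \<in> rotations \<rho> \<zeta> \<and> s \<in> J}"
    then obtain F s where F: "F \<in> rotations \<rho> \<zeta>" and s: "s \<in> J" and y: "y = F (\<gamma> s)" by blast
    have "\<exists>r. y = \<phi> r (\<gamma> s)"
      unfolding y by (rule orbit_eq[OF s rotation_distances(2)[OF F \<gamma>_in[OF s]]])
        (rule rotation_distances(1)[OF F \<gamma>_in[OF s]])
    then show "y \<in> S" using s by (auto simp: swept_surface_def)
  qed
next
  fix s c c'
  assume s: "s \<in> J" and c: "(\<forall>t. c t \<in> {F (\<gamma> s) | F. F \<in> rotations \<rho> \<zeta>}) \<and> c 0 = \<gamma> s \<and>
    (c has_vector_derivative c') (at 0)"
  then have c0: "c 0 = \<gamma> s" and c': "(c has_vector_derivative c') (at 0)" by auto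
  have dist: "form \<rho> (c t - axis_curve r) (c t - axis_curve r)
      = form \<rho> (\<gamma> s - axis_curve r) (\<gamma> s - axis_curve r)" and c_in: "c t \<in> space_form \<rho>" for t r
  proof -
    obtain F where F: "F \<in> rotations \<rho> \<zeta>" and ct: "c t = F (\<gamma> s)" using c by blast
    show "form \<rho> (c t - axis_curve r) (c t - axis_curve r)
        = form \<rho> (\<gamma> s - axis_curve r) (\<gamma> s - axis_curve r)" "c t \<in> space_form \<rho>"
      unfolding ct by (rule rotation_distances[OF F \<gamma>_in[OF s]])+
  qed
  \<comment> \<open>A curve in the orbit keeps its distances to the axis; their derivative at 0 is
    this product.\<close>
  have orth: "form \<rho> c' (\<gamma> s - axis_curve r) = 0" for r
  proof -
    have d: "((\<lambda>t. c t - axis_curve r) has_vector_derivative c') (at 0)"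
      using c' by (auto intro!: derivative_eq_intros)
    from derivatives_agree[OF open_UNIV UNIV_I dist form_has_derivative[OF d d] DERIV_const]
    show ?thesis by (simp add: c0 form_commute[of \<rho> _ c'])
  qed
  have "form \<rho> c' (axis_curve r) = form \<rho> c' p0" for r
    using orth[of r] orth[of 0] by (simp add: axis_0)
  then have ce: "form \<rho> c' e = 0" by (rule orthogonal_e)
  have cc: "form \<rho> c' (conormal \<rho> p0) = 0"
  proof (cases "\<rho> = 0")
    case True
    have "form \<rho> (axis 4 1) (c t) = 1" for t
      using c_in[of t] True by (subst form_commute) (simp add: form_axis space_form_flat)
    from derivatives_agree[OF open_UNIV UNIV_I this form_const_has_derivative[OF c'] DERIV_const]
    show ?thesis using True by (simp add: conormal_def form_commute)
  next
    case False
    have "form \<rho> (c t) (c t) = 1 / \<rho>" for t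
      using space_form_norm[OF c_in False] False by (simp add: field_simps)
    from derivatives_agree[OF open_UNIV UNIV_I this form_has_derivative[OF c' c'] DERIV_const]
    have "form \<rho> c' (\<gamma> s) = 0" by (simp add: c0 form_commute)
    then show ?thesis using orth[of 0] False by (simp add: axis_0 conormal_def)
  qed
  define a b where "a = form \<rho> c' B0" and "b = form \<rho> c' L / m"
  have c'_eq: "c' = a *\<^sub>R B0 + b *\<^sub>R L"
    unfolding a_def b_def by (rule orthogonal_plane[OF ce cc])
  have "form \<rho> c' (\<gamma> s - p0) = a * form \<rho> B0 (\<gamma> s - p0) + b * form \<rho> L (\<gamma> s - p0)"
    unfolding c'_eq by (simp only: form_linear(1,7))
  also have "\<dots> = b * (u s / 4)"
    unfolding \<alpha>_diff \<beta>_diff by (simp add: \<alpha>_curve \<beta>_curve s p0_forms)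
  \<comment> \<open>Against \<open>\<gamma> s - p0\<close>, the vector \<open>L\<close> has the
    positive product \<open>u s / 4\<close>. So \<open>c'\<close> is a multiple of the binormal,
    which is orthogonal to the curve.\<close>
  finally have "b = 0"
    using orth[of 0] u_pos[OF s] by (simp add: axis_0 del: form_linear)
  then show "form \<rho> c' (T s) = 0"
    by (simp add: c'_eq B0_T s)
qed

end

theorem theorem4p2:
  fixes \<rho> :: real and J :: "real set" and \<gamma> :: "real \<Rightarrow> real^4"
    and X :: "real^4 \<Rightarrow> real^4" and \<phi> :: "real \<Rightarrow> real^4 \<Rightarrow> real^4"
  assumes "arclength_curve \<rho> J \<gamma>"
    and "planar \<rho> J \<gamma>"
    and "extremal \<rho> J \<gamma>"
    and "\<not> curvature \<rho> \<gamma> constant_on J"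
    and "killing_field \<rho> X"
    and "\<forall>s\<in>J. X (\<gamma> s) = (1 / (4 * curvature \<rho> \<gamma> s powr (3/4))) *\<^sub>R binormal \<rho> \<gamma> s"
    and "flow_of \<rho> X \<phi>"
  shows "immersed_surface \<rho> (sweep_domain J) (sweep \<gamma> \<phi>)
    \<and> sweep \<gamma> \<phi> ` sweep_domain J = swept_surface J \<gamma> \<phi>
    \<and> (0 \<le> \<rho> \<or> (\<exists>s\<in>J. 0 < first_integral \<rho> \<gamma> s) \<longrightarrow>
         (\<exists>\<zeta>. rotational_about \<rho> \<zeta> (swept_surface J \<gamma> \<phi>)
            \<and> profile_curve \<rho> \<zeta> (swept_surface J \<gamma> \<phi>) J \<gamma>))
    \<and> (\<exists>\<eta> k1 k2. unit_normal \<rho> (sweep_domain J) (sweep \<gamma> \<phi>) \<eta>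
         \<and> linear_weingarten \<rho> (sweep_domain J) (sweep \<gamma> \<phi>) \<eta> k1 k2
         \<and> (\<forall>q\<in>sweep_domain J. 3 * k1 q + k2 q = 0 \<and> k1 q = - curvature \<rho> \<gamma> (q$1))
         \<and> biconservative \<rho> (sweep_domain J) (sweep \<gamma> \<phi>) \<eta>
         \<and> \<not> CMC \<rho> (sweep_domain J) (sweep \<gamma> \<phi>) \<eta>)"
proof -
  obtain r where r: "r \<in> J" using assms(1) by (auto simp: arclength_curve_def)
  have loc: "extremal_curve \<rho> J \<gamma> X \<phi> s" if "s \<in> J" for s
    using assms that by unfold_locales (auto simp: extremal_def)
  interpret extremal_curve \<rho> J \<gamma> X \<phi> r by (rule loc[OF r])
  have "\<exists>\<zeta>. rotational_about \<rho> \<zeta> (swept_surface J \<gamma> \<phi>)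
      \<and> profile_curve \<rho> \<zeta> (swept_surface J \<gamma> \<phi>) J \<gamma>"
    if "0 \<le> \<rho> \<or> (\<exists>s\<in>J. 0 < first_integral \<rho> \<gamma> s)"
  proof -
    have "0 < first_integral \<rho> \<gamma> r" if "0 \<le> \<rho>"
    proof -
      \<comment> \<open>For nonnegative \<open>\<rho>\<close> this summand alone makes the first
        integral positive.\<close>
      have "0 < 9 * sqrt (\<kappa> r)" using curvature_pos[OF r] by simp
      then show ?thesis
        unfolding first_integral_def using that by (intro add_nonneg_pos) auto
    qed
    with that r obtain s where s: "s \<in> J" "0 < first_integral \<rho> \<gamma> s" by blast
    \<comment> \<open>The base point is moved to a parameter where the first integral is positive,
      since \<open>m\<close> is computed there.\<close>
    interpret s: extremal_curve \<rho> J \<gamma> X \<phi> s by (rule loc[OF s(1)])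
    interpret rotational_curve \<rho> J \<gamma> X \<phi> s
      by unfold_locales (use s.m_eq s(2) in simp)
    show ?thesis using rotational profile by blast
  qed
  then show ?thesis
    using immersed sweep_image surface_conclusion[OF assms(4)] by blast
qed

end
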